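(* Let $\eta>0$, $\alpha\in(1/2,1)$, $\eta_i=\eta i^{-\alpha}$, let $e_i\overset{\mathrm{i.i.d.}}{\sim}\mathcal N(0,\sigma_e^2)$, and let $X_0=0$, $X_i=(1-\eta_i)X_{i-1}+\eta_ie_i$ for $i\ge1$. Let $\ell_i=\lfloor Ci^{\alpha}\log i\rfloor$ with $\eta C>1$, $t_i=i-\ell_i+1$, $W_i=\sum_{j=t_i}^{i-1}X_j$, and $$\widehat\sigma_n=\frac1n\sum_{i=1}^n\big[X_i^2+2X_iW_i\big],\qquad \sigma_n=\mathrm{Var}(\sqrt n\,\bar X_n)=\frac1n\mathbb{E}\Big|\sum_{i=1}^nX_i\Big|^2.$$ Then $\mathbb{E}[(\widehat\sigma_n-\sigma_n)^2]\asymp n^{-1+\alpha}\log n$.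
   Context: $\bar X_n=n^{-1}\sum_{i=1}^nX_i$. $a_n\asymp b_n$ means $c b_n\le a_n\le C' b_n$ for constants $0<c\le C'$ independent of $n$. *)

theory Defs
  imports "HOL-Probability.Probability"
begin

definition step_size :: "real \<Rightarrow> real \<Rightarrow> nat \<Rightarrow> real" where
  "step_size \<eta> \<alpha> i = \<eta> * real i powr (-\<alpha>)"

fun Xseq :: "real \<Rightarrow> real \<Rightarrow> (nat \<Rightarrow> 'a \<Rightarrow> real) \<Rightarrow> nat \<Rightarrow> 'a \<Rightarrow> real" where
  "Xseq \<eta> \<alpha> e 0 \<omega> = 0"
| "Xseq \<eta> \<alpha> e (Suc i) \<omega> =
     (1 - step_size \<eta> \<alpha> (Suc i)) * Xseq \<eta> \<alpha> e i \<omega> + step_size \<eta> \<alpha> (Suc i) * e (Suc i) \<omega>"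

definition ell :: "real \<Rightarrow> real \<Rightarrow> nat \<Rightarrow> int" where
  "ell C \<alpha> i = \<lfloor>C * real i powr \<alpha> * ln (real i)\<rfloor>"

text \<open>t_i = i - l_i + 1 (an integer, possibly nonpositive for small i).\<close>
definition tstart :: "real \<Rightarrow> real \<Rightarrow> nat \<Rightarrow> int" where
  "tstart C \<alpha> i = int i - ell C \<alpha> i + 1"

text \<open>W_i = sum_{j=t_i}^{i-1} X_j, with X_j := 0 for j \<le> 0 (X_0 = 0 anyway).\<close>
definition Wsum :: "real \<Rightarrow> real \<Rightarrow> real \<Rightarrow> (nat \<Rightarrow> 'a \<Rightarrow> real) \<Rightarrow> nat \<Rightarrow> 'a \<Rightarrow> real" where
  "Wsum \<eta> \<alpha> C e i \<omega> = (\<Sum>j\<in>{max 0 (tstart C \<alpha> i) .. int i - 1}. Xseq \<eta> \<alpha> e (nat j) \<omega>)"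

definition sigma_hat :: "real \<Rightarrow> real \<Rightarrow> real \<Rightarrow> (nat \<Rightarrow> 'a \<Rightarrow> real) \<Rightarrow> nat \<Rightarrow> 'a \<Rightarrow> real" where
  "sigma_hat \<eta> \<alpha> C e n \<omega> = (1 / real n) *
     (\<Sum>i=1..n. (Xseq \<eta> \<alpha> e i \<omega>)\<^sup>2 + 2 * Xseq \<eta> \<alpha> e i \<omega> * Wsum \<eta> \<alpha> C e i \<omega>)"

text \<open>sigma_n = Var(sqrt n * mean X) = (1/n) E |sum_{i=1}^n X_i|^2.\<close>
definition sigma_true :: "'a measure \<Rightarrow> real \<Rightarrow> real \<Rightarrow> (nat \<Rightarrow> 'a \<Rightarrow> real) \<Rightarrow> nat \<Rightarrow> real" where
  "sigma_true M \<eta> \<alpha> e n = (1 / real n) * (\<integral>\<omega>. (\<Sum>i=1..n. Xseq \<eta> \<alpha> e i \<omega>)\<^sup>2 \<partial>M)"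

end

theory Submission
  imports Defs "HOL-Real_Asymp.Real_Asymp"
begin

text \<open>
  Each \<open>X\<^sub>i\<close> is a linear combination of the noises with weights \<open>x i a\<close>, so \<open>n\<close> times the
  estimator is a quadratic form \<open>\<Sum>a b. A a b e\<^sub>a e\<^sub>b\<close>, and Isserlis' formula splits the mean squared
  error into \<open>\<sigma>\<^sup>4 \<Sum>a b. (A a b)\<^sup>2 + A a b A b a\<close> plus a squared bias.  The row and column sums of
  \<open>\<bar>x\<bar>\<close> are bounded, hence \<open>A\<close> has bounded entries, and the sum of their absolute values is at
  most a constant times the number of pairs in the windows, about \<open>n \<cdot> n\<^sup>\<alpha> log n\<close>; this product
  bounds the Frobenius norm from above.  For the lower bound, take \<open>a < b\<close> of order \<open>n\<close> with
  \<open>c n\<^sup>\<alpha> < b - a \<le> c' n\<^sup>\<alpha> log n\<close>: the first \<open>c n\<^sup>\<alpha>\<close> times from \<open>a\<close> on lie in the window of each of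
  the first \<open>c n\<^sup>\<alpha>\<close> times from \<open>b\<close> on, and the weights there are of order \<open>n powr (- \<alpha>)\<close>, so \<open>A b a\<close> is
  bounded away from zero.  The bias only collects covariances outside the windows, which decay like
  \<open>i powr (- \<eta> C)\<close> and are negligible because \<open>\<eta> C > 1\<close>.
\<close>

section \<open>Quadratic forms in independent centred normal variables\<close>

locale iid_normal = prob_space M for M :: "'a measure" +
  fixes e :: "nat \<Rightarrow> 'a \<Rightarrow> real" and \<sigma> :: real
  assumes sd_pos: "\<sigma> > 0"
    and indep: "indep_vars (\<lambda>_. borel) e {1..}"
    and normal: "i \<ge> 1 \<Longrightarrow> distributed M lborel (e i) (normal_density 0 \<sigma>)"
begin

lemma moment_integrable: "i \<ge> 1 \<Longrightarrow> integrable M (\<lambda>\<omega>. e i \<omega> ^ k)"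
  using distributed_integrable[OF normal, of i "\<lambda>x. x ^ k"]
    integrable_normal_moment[OF sd_pos, of 0 k]
  by simp

lemma moment_even:
  "i \<ge> 1 \<Longrightarrow> (\<integral>\<omega>. e i \<omega> ^ (2 * k) \<partial>M) = fact (2 * k) / ((2 / \<sigma>\<^sup>2) ^ k * fact k)"
  using distributed_integral[OF normal, of i "\<lambda>x. x ^ (2 * k)"]
    integral_normal_moment_even[OF sd_pos, of 0 k]
  by simp

lemma moment_odd: "i \<ge> 1 \<Longrightarrow> (\<integral>\<omega>. e i \<omega> ^ (2 * k + 1) \<partial>M) = 0"
  using distributed_integral[OF normal, of i "\<lambda>x. x ^ (2 * k + 1)"]
    integral_normal_moment_odd[OF sd_pos, of 0 k]
  by simp

lemma moments:
  assumes "i \<ge> 1"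
  shows "(\<integral>\<omega>. e i \<omega> \<partial>M) = 0" "(\<integral>\<omega>. e i \<omega> ^ 2 \<partial>M) = \<sigma>\<^sup>2"
    "(\<integral>\<omega>. e i \<omega> ^ 3 \<partial>M) = 0" "(\<integral>\<omega>. e i \<omega> ^ 4 \<partial>M) = 3 * \<sigma> ^ 4"
proof -
  show "(\<integral>\<omega>. e i \<omega> \<partial>M) = 0" "(\<integral>\<omega>. e i \<omega> ^ 2 \<partial>M) = \<sigma>\<^sup>2"
    using moment_odd[OF assms, of 0] moment_even[OF assms, of 1] by simp_all
  show "(\<integral>\<omega>. e i \<omega> ^ 3 \<partial>M) = 0"
    using moment_odd[OF assms, of 1] by (simp add: eval_nat_numeral)
  show "(\<integral>\<omega>. e i \<omega> ^ 4 \<partial>M) = 3 * \<sigma> ^ 4"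
    using moment_even[OF assms, of 2] by (simp add: fact_numeral power_divide)
qed

text \<open>Independence factorises expectations over distinct indices only, so repeated indices in
  a product of noises are encoded as exponents \<open>k i\<close>.\<close>

lemma monomial_has_integral:
  assumes "finite I" "I \<subseteq> {1..}"
  shows "has_bochner_integral M (\<lambda>\<omega>. \<Prod>i\<in>I. e i \<omega> ^ k i) (\<Prod>i\<in>I. \<integral>\<omega>. e i \<omega> ^ k i \<partial>M)"
proof -
  have ind: "indep_vars (\<lambda>_. borel) (\<lambda>i \<omega>. e i \<omega> ^ k i) I"
    by (rule indep_vars_compose2[OF indep_vars_subset[OF indep assms(2)]]) measurable
  have int: "i \<in> I \<Longrightarrow> integrable M (\<lambda>\<omega>. e i \<omega> ^ k i)" for i
    using assms(2) by (intro moment_integrable) auto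
  show ?thesis
    unfolding has_bochner_integral_iff
    using indep_vars_lebesgue_integral[OF assms(1) ind int] indep_vars_integrable[OF assms(1) ind int]
    by simp
qed

lemma isserlis2:
  assumes "a \<ge> 1" "b \<ge> 1"
  shows "has_bochner_integral M (\<lambda>\<omega>. e a \<omega> * e b \<omega>) (\<sigma>\<^sup>2 * of_bool (a = b))"
proof -
  let ?k = "\<lambda>i. of_bool (i = a) + of_bool (i = b) :: nat"
  have "(\<Prod>i\<in>{a, b}. e i \<omega> ^ ?k i) = e a \<omega> * e b \<omega>" for \<omega>
    by (cases "a = b") (auto simp: power2_eq_square)
  moreover have "(\<Prod>i\<in>{a, b}. \<integral>\<omega>. e i \<omega> ^ ?k i \<partial>M) = \<sigma>\<^sup>2 * of_bool (a = b)"
    using assms moments[of a] by (cases "a = b") (simp_all add: power2_eq_square)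
  ultimately show ?thesis
    using monomial_has_integral[of "{a, b}" ?k] assms by auto
qed

text \<open>The exponent \<open>?k i\<close> is the multiplicity of \<open>i\<close> among the four
  indices, and odd multiplicities give moment 0. The fourth moment \<open>3 * \<sigma> ^ 4\<close>
  is what the three pairings contribute when all four indices agree.\<close>

lemma isserlis4:
  assumes "a \<ge> 1" "b \<ge> 1" "c \<ge> 1" "d \<ge> 1"
  shows "has_bochner_integral M (\<lambda>\<omega>. e a \<omega> * e b \<omega> * (e c \<omega> * e d \<omega>))
    (\<sigma> ^ 4 * (of_bool (a = b \<and> c = d) + of_bool (a = c \<and> b = d) + of_bool (a = d \<and> b = c)))"
proof -
  let ?I = "{a, b, c, d}"
  let ?k = "\<lambda>i. of_bool (i = a) + of_bool (i = b) + of_bool (i = c) + of_bool (i = d) :: nat"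
  have pow: "x ^ of_bool P = (if P then x else 1)" for x :: real and P
    by simp
  have "(\<Prod>i\<in>?I. e i \<omega> ^ ?k i) = e a \<omega> * e b \<omega> * (e c \<omega> * e d \<omega>)" for \<omega>
    unfolding power_add prod.distrib pow by simp
  \<comment> \<open>All noises have the same moments, so one function of the exponent serves every
    index and the split on coinciding indices becomes arithmetic.\<close>
  moreover define \<mu> where "\<mu> k = (\<integral>\<omega>. e 1 \<omega> ^ k \<partial>M)" for k
  have \<mu>: "\<mu> (Suc 0) = 0" "\<mu> (Suc (Suc 0)) = \<sigma>\<^sup>2" "\<mu> (Suc (Suc (Suc 0))) = 0"
    "\<mu> (Suc (Suc (Suc (Suc 0)))) = 3 * \<sigma> ^ 4"
    using moments[of 1] by (simp_all add: \<mu>_def eval_nat_numeral)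
  have eq: "(\<integral>\<omega>. e i \<omega> ^ k \<partial>M) = \<mu> k" if "i \<ge> 1" for i k
    unfolding \<mu>_def using that
    by (cases "even k") (auto elim!: evenE oddE simp: moment_even moment_odd[simplified])
  have "(\<Prod>i\<in>?I. \<integral>\<omega>. e i \<omega> ^ ?k i \<partial>M) = (\<Prod>i\<in>?I. \<mu> (?k i))"
    by (intro prod.cong refl eq) (use assms in auto)
  moreover have "(\<Prod>i\<in>?I. \<mu> (?k i)) =
      \<sigma> ^ 4 * (of_bool (a = b \<and> c = d) + of_bool (a = c \<and> b = d) + of_bool (a = d \<and> b = c))"
    by (cases "a = b"; cases "a = c"; cases "a = d"; cases "b = c"; cases "b = d"; cases "c = d")
      (simp_all add: \<mu> insert_absorb insert_commute flip: power_add)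
  ultimately show ?thesis
    using monomial_has_integral[of ?I ?k] assms by auto
qed

lemma quadratic_form_mean:
  assumes "finite I" "I \<subseteq> {1..}"
  shows "has_bochner_integral M (\<lambda>\<omega>. \<Sum>a\<in>I. \<Sum>b\<in>I. A a b * (e a \<omega> * e b \<omega>)) (\<sigma>\<^sup>2 * (\<Sum>a\<in>I. A a a))"
proof -
  have "has_bochner_integral M (\<lambda>\<omega>. \<Sum>a\<in>I. \<Sum>b\<in>I. A a b * (e a \<omega> * e b \<omega>))
      (\<Sum>a\<in>I. \<Sum>b\<in>I. A a b * (\<sigma>\<^sup>2 * of_bool (a = b)))"
    using assms by (intro has_bochner_integral_sum has_bochner_integral_mult_right isserlis2) auto
  also have "(\<Sum>a\<in>I. \<Sum>b\<in>I. A a b * (\<sigma>\<^sup>2 * of_bool (a = b))) = \<sigma>\<^sup>2 * (\<Sum>a\<in>I. A a a)"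
    using assms by (simp add: of_bool_def if_distrib sum_distrib_left mult.commute cong: if_cong)
  finally show ?thesis .
qed

text \<open>The three pairings yield the squared trace, the squared Frobenius norm and the sum of
  \<open>A a b * A b a\<close>; the last two stay apart because \<open>A\<close> need not be
  symmetric.\<close>

lemma quadratic_form_square:
  assumes "finite I" "I \<subseteq> {1..}"
  shows "has_bochner_integral M (\<lambda>\<omega>. (\<Sum>a\<in>I. \<Sum>b\<in>I. A a b * (e a \<omega> * e b \<omega>))\<^sup>2)
    (\<sigma> ^ 4 * ((\<Sum>a\<in>I. A a a)\<^sup>2 + (\<Sum>a\<in>I. \<Sum>b\<in>I. (A a b)\<^sup>2 + A a b * A b a)))"
proof -
  let ?S = "\<lambda>f. \<Sum>a\<in>I. \<Sum>b\<in>I. \<Sum>c\<in>I. \<Sum>d\<in>I. (f a b c d :: real)"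
  have \<delta>: "(\<Sum>j\<in>I. of_bool (j = i) * f j) = f i" if "i \<in> I" for i and f :: "nat \<Rightarrow> real"
    using assms(1) that by (simp add: of_bool_def mult_delta_left)
  have sq: "(\<Sum>a\<in>I. \<Sum>b\<in>I. f a b)\<^sup>2 = ?S (\<lambda>a b c d. f a b * f c d)" for f :: "nat \<Rightarrow> nat \<Rightarrow> real"
    unfolding power2_eq_square sum_product
    by (intro sum.cong refl sum.swap)
  have "has_bochner_integral M
      (\<lambda>\<omega>. ?S (\<lambda>a b c d. (A a b * A c d) * (e a \<omega> * e b \<omega> * (e c \<omega> * e d \<omega>))))
      (?S (\<lambda>a b c d. (A a b * A c d) * (\<sigma> ^ 4 *
        (of_bool (a = b \<and> c = d) + of_bool (a = c \<and> b = d) + of_bool (a = d \<and> b = c)))))"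
    using assms by (intro has_bochner_integral_sum has_bochner_integral_mult_right isserlis4) auto
  also have "(\<lambda>\<omega>. ?S (\<lambda>a b c d. (A a b * A c d) * (e a \<omega> * e b \<omega> * (e c \<omega> * e d \<omega>)))) =
      (\<lambda>\<omega>. (\<Sum>a\<in>I. \<Sum>b\<in>I. A a b * (e a \<omega> * e b \<omega>))\<^sup>2)"
    unfolding sq by (simp add: mult_ac)
  \<comment> \<open>Each pairing becomes two deltas, the one on the innermost variable
    \<open>d\<close> outermost, so that \<open>\<delta>\<close> removes the sums from the inside
    out.\<close>
  also have "?S (\<lambda>a b c d. (A a b * A c d) * (\<sigma> ^ 4 *
        (of_bool (a = b \<and> c = d) + of_bool (a = c \<and> b = d) + of_bool (a = d \<and> b = c)))) =
      \<sigma> ^ 4 * (?S (\<lambda>a b c d. of_bool (d = c) * (of_bool (b = a) * (A a b * A c d))) +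
        ?S (\<lambda>a b c d. of_bool (d = b) * (of_bool (c = a) * (A a b * A c d))) +
        ?S (\<lambda>a b c d. of_bool (d = a) * (of_bool (c = b) * (A a b * A c d))))"
    unfolding sum_distrib_left sum.distrib[symmetric] by (intro sum.cong refl) auto
  also have "?S (\<lambda>a b c d. of_bool (d = c) * (of_bool (b = a) * (A a b * A c d))) = (\<Sum>a\<in>I. A a a)\<^sup>2"
    by (simp add: \<delta> power2_eq_square sum_product cong: sum.cong_simp flip: sum_distrib_left)
  also have "?S (\<lambda>a b c d. of_bool (d = b) * (of_bool (c = a) * (A a b * A c d))) = (\<Sum>a\<in>I. \<Sum>b\<in>I. (A a b)\<^sup>2)"
    by (simp add: \<delta> power2_eq_square cong: sum.cong_simp)
  also have "?S (\<lambda>a b c d. of_bool (d = a) * (of_bool (c = b) * (A a b * A c d))) = (\<Sum>a\<in>I. \<Sum>b\<in>I. A a b * A b a)"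
    by (simp add: \<delta> cong: sum.cong_simp)
  finally show ?thesis
    by (simp add: sum.distrib add.assoc)
qed

text \<open>Bias-variance decomposition: the squared trace in the second moment completes the terms
  in \<open>t\<close> to the squared bias.\<close>

lemma quadratic_form_mse:
  assumes "finite I" "I \<subseteq> {1..}"
  shows "(\<integral>\<omega>. ((\<Sum>a\<in>I. \<Sum>b\<in>I. A a b * (e a \<omega> * e b \<omega>)) - t)\<^sup>2 \<partial>M) =
    \<sigma> ^ 4 * (\<Sum>a\<in>I. \<Sum>b\<in>I. (A a b)\<^sup>2 + A a b * A b a) + (\<sigma>\<^sup>2 * (\<Sum>a\<in>I. A a a) - t)\<^sup>2"
proof -
  define Q where "Q \<omega> = (\<Sum>a\<in>I. \<Sum>b\<in>I. A a b * (e a \<omega> * e b \<omega>))" for \<omega>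
  note m = quadratic_form_mean[OF assms, of A, folded Q_def]
  note s = quadratic_form_square[OF assms, of A, folded Q_def]
  have "has_bochner_integral M (\<lambda>\<omega>. (Q \<omega>)\<^sup>2 - 2 * t * Q \<omega> + t\<^sup>2)
     (\<sigma> ^ 4 * ((\<Sum>a\<in>I. A a a)\<^sup>2 + (\<Sum>a\<in>I. \<Sum>b\<in>I. (A a b)\<^sup>2 + A a b * A b a))
       - 2 * t * (\<sigma>\<^sup>2 * (\<Sum>a\<in>I. A a a)) + t\<^sup>2 * measure M (space M))"
    by (intro has_bochner_integral_add has_bochner_integral_diff has_bochner_integral_mult_right m s)
      (simp add: has_bochner_integral_iff)
  then show ?thesis
    unfolding Q_def[symmetric] has_bochner_integral_iff
    by (simp add: prob_space power2_eq_square power4_eq_xxxx algebra_simps)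
qed

end

section \<open>The weights of the noises\<close>

text \<open>The map from \<open>j\<close> to \<open>i - j - d\<close> is injective on
  \<open>S\<close>, so factoring out \<open>r ^ d\<close> leaves part of a geometric series.\<close>

lemma sum_geometric_tail_le:
  fixes r :: real
  assumes "0 < r" "r < 1" "finite S" "\<And>j. j \<in> S \<Longrightarrow> j \<le> i \<and> d \<le> i - j"
  shows "(\<Sum>j\<in>S. r ^ (i - j)) \<le> r ^ d / (1 - r)"
proof -
  let ?h = "\<lambda>j. i - j - d"
  have "(\<Sum>j\<in>S. r ^ (i - j)) = r ^ d * (\<Sum>j\<in>S. r ^ ?h j)"
    unfolding sum_distrib_left power_add[symmetric] using assms(4)
    by (intro sum.cong refl arg_cong[where f = "(^) r"]) (simp only: le_add_diff_inverse)
  also have "(\<Sum>j\<in>S. r ^ ?h j) = sum ((^) r) (?h ` S)"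
  proof (subst sum.reindex)
    show "inj_on ?h S"
    proof (rule inj_onI)
      fix j k assume "j \<in> S" "k \<in> S" "?h j = ?h k"
      with assms(4)[of j] assms(4)[of k] show "j = k" by linarith
    qed
  qed simp
  also have "\<dots> \<le> 1 / (1 - r)"
    using sum_le_suminf[of "(^) r" "?h ` S"] assms by (simp add: suminf_geometric)
  finally show ?thesis
    using assms(1) by (simp add: field_simps)
qed

lemma bounded_if_eventually_nonincreasing:
  fixes f :: "nat \<Rightarrow> real"
  assumes "\<And>n. n \<ge> N \<Longrightarrow> f (Suc n) \<le> max c (f n)"
  shows "\<exists>K. \<forall>n. f n \<le> K"
proof -
  define K where "K = max c (Max (f ` {..N}))"
  have "f n \<le> K" for n
  proof (induction n)
    case 0 show ?case unfolding K_def by (rule max.coboundedI2) (auto intro: Max_ge)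
  next
    case (Suc n)
    show ?case
    proof (cases "n \<ge> N")
      case True with assms[OF True] Suc show ?thesis by (auto simp: K_def)
    next
      case False then show ?thesis unfolding K_def by (intro max.coboundedI2 Max_ge) auto
    qed
  qed
  then show ?thesis by blast
qed

text \<open>By the mean value theorem each summand, times \<open>\<alpha>\<close>, is at most an
  increment of the \<alpha>-th power, whose derivative is decreasing. The step from 0 is separate
  since the derivative does not exist at 0.\<close>

lemma sum_powr_le:
  fixes \<alpha> :: real
  assumes "0 < \<alpha>" "\<alpha> < 1"
  shows "(\<Sum>i\<in>{1..n}. real i powr (\<alpha> - 1)) \<le> real n powr \<alpha> / \<alpha>"
proof (induction n)
  case (Suc n)
  show ?case
  proof (cases "n = 0")
    case False
    have "\<exists>z>real n. z < real (Suc n) \<and>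
        real (Suc n) powr \<alpha> - real n powr \<alpha> = (real (Suc n) - real n) * (\<alpha> * z powr (\<alpha> - 1))"
      using False by (intro MVT2) (auto intro!: DERIV_fun_powr[THEN DERIV_cong] derivative_eq_intros)
    then obtain z where z: "real n < z" "z < real (Suc n)"
      "real (Suc n) powr \<alpha> - real n powr \<alpha> = \<alpha> * z powr (\<alpha> - 1)" by auto
    have "\<alpha> * real (Suc n) powr (\<alpha> - 1) \<le> \<alpha> * z powr (\<alpha> - 1)"
      using z assms False by (intro mult_left_mono powr_mono2') auto
    moreover have "\<alpha> * (\<Sum>i\<in>{1..n}. real i powr (\<alpha> - 1)) \<le> real n powr \<alpha>"
      using Suc assms by (simp add: field_simps)
    ultimately have "\<alpha> * (\<Sum>i\<in>{1..n}. real i powr (\<alpha> - 1)) + \<alpha> * real (Suc n) powr (\<alpha> - 1)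
        \<le> real (Suc n) powr \<alpha>"
      using z(3) by linarith
    then have "\<alpha> * (\<Sum>i\<in>{1..Suc n}. real i powr (\<alpha> - 1)) \<le> real (Suc n) powr \<alpha>"
      by (simp add: distrib_left)
    then show ?thesis using assms by (subst pos_le_divide_eq) (auto simp: mult.commute)
  qed (use assms in simp)
qed simp

section \<open>Transition factors and weights of the recursion\<close>

locale sgd =
  fixes \<eta> \<alpha> :: real
  assumes eta_pos: "\<eta> > 0" and alpha_pos: "0 < \<alpha>" and alpha_less: "\<alpha> < 1"
begin

abbreviation s :: "nat \<Rightarrow> real" where "s \<equiv> step_size \<eta> \<alpha>"

text \<open>The coefficient with which X_j enters X_i.\<close>

definition P :: "nat \<Rightarrow> nat \<Rightarrow> real" where
  "P j i = (\<Prod>k\<in>{j<..i}. 1 - s k)"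

text \<open>The weight of \<open>e a\<close> in X_i. Extending it by 0 lets all sums over
  \<open>a\<close> share the range \<open>{1..n}\<close>.\<close>

definition x :: "nat \<Rightarrow> nat \<Rightarrow> real" where
  "x i a = (if 1 \<le> a \<and> a \<le> i then s a * P a i else 0)"

lemma s_nonneg: "s k \<ge> 0"
  using eta_pos by (simp add: step_size_def)

lemma s_antimono: "1 \<le> j \<Longrightarrow> j \<le> k \<Longrightarrow> s k \<le> s j"
  using eta_pos alpha_pos by (simp add: step_size_def powr_mono2')

text \<open>Since \<eta> is arbitrary, early step sizes may exceed 1. From \<open>N\<close> on the
  factors \<open>1 - s k\<close> lie between 0 and 1, which supplies signs and convexity
  below.\<close>

lemma s_eventually_le_1: "\<exists>N\<ge>1. \<forall>k\<ge>N. s k \<le> 1"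
proof -
  have "(\<lambda>k. \<eta> * real k powr (- \<alpha>)) \<longlonglongrightarrow> 0"
    using alpha_pos by real_asymp
  then have "\<forall>\<^sub>F k in sequentially. s k < 1"
    unfolding step_size_def by (rule order_tendstoD) simp
  then obtain N where N: "\<And>k. k \<ge> N \<Longrightarrow> s k < 1"
    by (auto simp: eventually_sequentially)
  show ?thesis
    by (intro exI[of _ "max 1 N"]) (auto intro: less_imp_le[OF N])
qed

lemma P_refl [simp]: "P i i = 1"
  by (simp add: P_def)

lemma P_Suc: "j \<le> i \<Longrightarrow> P j (Suc i) = (1 - s (Suc i)) * P j i"
  unfolding P_def by (simp flip: atLeastSucAtMost_greaterThanAtMost)

lemma P_mult: "a \<le> j \<Longrightarrow> j \<le> i \<Longrightarrow> P a i = P a j * P j i"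
  unfolding P_def by (subst prod.union_disjoint[symmetric]) (auto simp: ivl_disj_un intro: prod.cong)

lemma Xseq_eq_sum:
  "i \<le> n \<Longrightarrow> Xseq \<eta> \<alpha> e i \<omega> = (\<Sum>a\<in>{1..n}. x i a * e a \<omega>)"
proof (induction i)
  case 0
  show ?case by (simp add: x_def)
next
  case (Suc i)
  have "x (Suc i) a * e a \<omega> = (1 - s (Suc i)) * (x i a * e a \<omega>) + (if a = Suc i then s a * e a \<omega> else 0)" for a
    by (auto simp: x_def P_Suc le_Suc_eq)
  then have "(\<Sum>a\<in>{1..n}. x (Suc i) a * e a \<omega>) =
      (1 - s (Suc i)) * (\<Sum>a\<in>{1..n}. x i a * e a \<omega>) + (\<Sum>a\<in>{1..n}. if a = Suc i then s a * e a \<omega> else 0)"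
    by (simp add: sum.distrib sum_distrib_left)
  then show ?case using Suc by simp
qed

text \<open>For small \<open>k\<close> the factor \<open>1 - s k\<close> may be negative or larger than 1 in absolute value; these
  finitely many factors are absorbed into \<open>K\<close>.\<close>
lemma P_exp_bound: "\<exists>K>0. \<forall>j i. \<bar>P j i\<bar> \<le> K * exp (- (\<Sum>k\<in>{j<..i}. s k))"
proof -
  obtain N where N: "\<And>k. k \<ge> N \<Longrightarrow> s k \<le> 1" using s_eventually_le_1 by auto
  \<comment> \<open>If \<open>s k > 1\<close>, then
    \<open>s k - 1 \<le> exp (s k) = exp (2 * s k - s k)\<close>, so the correction
    \<open>2 * s k\<close> suffices; this happens only for \<open>k \<le> N\<close>.\<close>
  let ?c = "\<lambda>k. if k \<le> N then 2 * s k else 0"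
  have factor: "\<bar>1 - s k\<bar> \<le> exp (?c k - s k)" for k
  proof (cases "s k \<le> 1")
    case True
    have "1 - s k \<le> exp (- s k)" using exp_ge_add_one_self[of "- s k"] by simp
    also have "\<dots> \<le> exp (?c k - s k)" using s_nonneg[of k] by simp
    finally show ?thesis using True by simp
  next
    case False
    then have "k \<le> N" using N[of k] by fastforce
    have "s k - 1 \<le> exp (s k)" using exp_ge_add_one_self[of "s k"] by linarith
    then show ?thesis using False \<open>k \<le> N\<close> by simp
  qed
  have "\<bar>P j i\<bar> \<le> exp (\<Sum>k\<le>N. 2 * s k) * exp (- (\<Sum>k\<in>{j<..i}. s k))" for j i
  proof -
    have "\<bar>P j i\<bar> \<le> (\<Prod>k\<in>{j<..i}. exp (?c k - s k))"
      unfolding P_def abs_prod by (intro prod_mono) (use factor in auto)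
    also have "\<dots> = exp (\<Sum>k\<in>{j<..i}. ?c k) * exp (- (\<Sum>k\<in>{j<..i}. s k))"
      unfolding exp_add[symmetric] exp_sum[OF finite_greaterThanAtMost, symmetric] sum_subtractf by simp
    also have "(\<Sum>k\<in>{j<..i}. ?c k) = (\<Sum>k\<in>{j<..i} \<inter> {..N}. 2 * s k)"
      by (auto simp: sum.If_cases Int_def)
    also have "\<dots> \<le> (\<Sum>k\<le>N. 2 * s k)"
      by (intro sum_mono2) (auto simp: s_nonneg)
    finally show ?thesis by simp
  qed
  then show ?thesis by (intro exI[of _ "exp (\<Sum>k\<le>N. 2 * s k)"]) auto
qed

lemma P_bounded: "\<exists>K>0. \<forall>j i. \<bar>P j i\<bar> \<le> K"
proof -
  obtain K where K: "K > 0" "\<And>j i. \<bar>P j i\<bar> \<le> K * exp (- (\<Sum>k\<in>{j<..i}. s k))"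
    using P_exp_bound by auto
  have "K * exp (- (\<Sum>k\<in>{j<..i}. s k)) \<le> K * 1" for j i :: nat
    using K(1) by (intro mult_left_mono) (auto intro!: sum_nonneg s_nonneg)
  with K show ?thesis by (metis mult.right_neutral order.trans)
qed

text \<open>Step sizes decrease, so each of the \<open>i - j\<close> terms in the exponent of
  \<open>P_exp_bound\<close> is at least \<open>s i\<close>.\<close>

lemma P_geometric_bound:
  "\<exists>K>0. \<forall>i\<ge>1. \<forall>j\<le>i. \<bar>P j i\<bar> \<le> K * exp (- s i) ^ (i - j)"
proof -
  obtain K where K: "K > 0" "\<And>j i. \<bar>P j i\<bar> \<le> K * exp (- (\<Sum>k\<in>{j<..i}. s k))"
    using P_exp_bound by auto
  have "\<bar>P j i\<bar> \<le> K * exp (- s i) ^ (i - j)" if "i \<ge> 1" "j \<le> i" for i j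
  proof -
    have "(\<Sum>k\<in>{j<..i}. s i) \<le> (\<Sum>k\<in>{j<..i}. s k)"
      using that by (intro sum_mono s_antimono) auto
    then have "exp (- (\<Sum>k\<in>{j<..i}. s k)) \<le> exp (- s i) ^ (i - j)"
      using that by (simp add: exp_of_nat_mult[symmetric] of_nat_diff)
    with K(1) have "K * exp (- (\<Sum>k\<in>{j<..i}. s k)) \<le> K * exp (- s i) ^ (i - j)"
      by (intro mult_left_mono) auto
    with K(2)[of j i] show ?thesis by linarith
  qed
  with K(1) show ?thesis by blast
qed

section \<open>Row and column sums of the weights\<close>

text \<open>Once \<open>s (Suc i) \<le> 1\<close>, the new row sum is a convex combination of the
  old one and 1.\<close>

lemma noise_weight_sum_bounded: "\<exists>R. \<forall>i. (\<Sum>a\<in>{1..i}. \<bar>x i a\<bar>) \<le> R"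
proof -
  obtain N where N: "\<And>k. k \<ge> N \<Longrightarrow> s k \<le> 1" using s_eventually_le_1 by auto
  define r where "r i = (\<Sum>a\<in>{1..i}. \<bar>x i a\<bar>)" for i
  have "r (Suc i) \<le> max 1 (r i)" if "i \<ge> N" for i
  proof -
    have s1: "0 \<le> s (Suc i)" "s (Suc i) \<le> 1" using N[of "Suc i"] that s_nonneg by auto
    have "r (Suc i) = (\<Sum>a\<in>{1..i}. \<bar>x (Suc i) a\<bar>) + \<bar>x (Suc i) (Suc i)\<bar>"
      unfolding r_def by simp
    also have "(\<Sum>a\<in>{1..i}. \<bar>x (Suc i) a\<bar>) = (1 - s (Suc i)) * r i"
      unfolding r_def sum_distrib_left using s1
      by (intro sum.cong) (auto simp: x_def P_Suc abs_mult)
    also have "\<bar>x (Suc i) (Suc i)\<bar> = s (Suc i) * 1" using s1 by (simp add: x_def)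
    also have "(1 - s (Suc i)) * r i + s (Suc i) * 1 \<le>
       (1 - s (Suc i)) * max 1 (r i) + s (Suc i) * max 1 (r i)"
      using s1 by (intro add_mono mult_left_mono) auto
    finally show ?thesis by (simp add: algebra_simps)
  qed
  from bounded_if_eventually_nonincreasing[of N r 1, OF this] show ?thesis
    unfolding r_def by blast
qed

text \<open>A noise entering at time \<open>a\<close> is forgotten on the time scale
  \<open>a powr \<alpha> / \<eta>\<close>, so the transition factors \<open>S a n\<close> sum to at
  most this order, which the prefactor \<open>s a\<close> cancels.\<close>

lemma noise_influence_bounded: "\<exists>D. \<forall>a n. (\<Sum>i\<in>{1..n}. \<bar>x i a\<bar>) \<le> D"
proof -
  have "(\<lambda>a. real (Suc a) powr \<alpha> - real a powr \<alpha>) \<longlonglongrightarrow> 0"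
    using alpha_pos alpha_less by real_asymp
  then have "\<forall>\<^sub>F a in sequentially. real (Suc a) powr \<alpha> - real a powr \<alpha> < \<eta> / 2"
    using eta_pos by (intro order_tendstoD) auto
  then obtain N1 where N1: "\<And>a. a \<ge> N1 \<Longrightarrow> real (Suc a) powr \<alpha> - real a powr \<alpha> < \<eta> / 2"
    by (auto simp: eventually_sequentially)
  obtain N2 where N2: "N2 \<ge> 1" "\<And>k. k \<ge> N2 \<Longrightarrow> s k \<le> 1" using s_eventually_le_1 by auto
  obtain N3 where N3: "\<And>k. k \<ge> N3 \<Longrightarrow> real k powr \<alpha> \<ge> \<eta> / 2"
  proof -
    have "filterlim (\<lambda>k. real k powr \<alpha>) at_top sequentially" using alpha_pos by real_asymp
    then have "\<forall>\<^sub>F k in sequentially. real k powr \<alpha> \<ge> \<eta> / 2" unfolding filterlim_at_top by blast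
    then show ?thesis using that unfolding eventually_sequentially by blast
  qed
  define N where "N = max N1 (max N2 N3)"
  define S where "S a n = (\<Sum>i\<in>{a..n}. \<bar>P a i\<bar>)" for a n
  \<comment> \<open>Backward recursion \<open>S a n = 1 + (1 - s (Suc a)) * S (Suc a) n\<close>; the bound is preserved because
    \<open>a powr \<alpha>\<close> has increments tending to 0.\<close>
  have large: "S a n \<le> 2 / \<eta> * real a powr \<alpha>" if "a \<ge> N" for a n
    using that
  proof (induction "n - a" arbitrary: a)
    case 0
    have "S a n \<le> 1" unfolding S_def using 0 by (cases "a = n") auto
    also have "1 \<le> 2 / \<eta> * real a powr \<alpha>"
      using N3[of a] 0(2) eta_pos by (simp add: N_def field_simps)
    finally show ?case .
  next
    case (Suc d)
    have an: "a < n" using Suc(2) by simp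
    have s1: "0 \<le> s (Suc a)" "s (Suc a) \<le> 1" using N2(2)[of "Suc a"] Suc(3) s_nonneg by (auto simp: N_def)
    have "S a n = 1 + (\<Sum>i\<in>{Suc a..n}. \<bar>P a i\<bar>)"
      unfolding S_def using an by (subst sum.atLeast_Suc_atMost) auto
    also have "(\<Sum>i\<in>{Suc a..n}. \<bar>P a i\<bar>) = (1 - s (Suc a)) * S (Suc a) n"
      unfolding S_def sum_distrib_left using s1
      by (intro sum.cong refl) (auto simp: P_mult[of a "Suc a"] P_Suc abs_mult)
    also have "\<dots> \<le> (1 - s (Suc a)) * (2 / \<eta> * real (Suc a) powr \<alpha>)"
      using Suc s1 by (intro mult_left_mono Suc(1)) auto
    \<comment> \<open>Of the 2 gained here, 1 pays for the summand \<open>i = a\<close> and 1 for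
      lowering \<open>Suc a\<close> to \<open>a\<close>, since by \<open>N1\<close> the power grows
      by less than \<open>\<eta> / 2\<close>.\<close>
    also have "\<dots> = 2 / \<eta> * real (Suc a) powr \<alpha> - 2"
      using eta_pos by (simp add: step_size_def field_simps powr_minus)
    finally show ?case
      using N1[of a] Suc(3) eta_pos by (simp add: N_def field_simps)
  qed
  obtain K where K: "K > 0" "\<And>j i. \<bar>P j i\<bar> \<le> K" using P_bounded by auto
  \<comment> \<open>Split at \<open>N\<close>: at most \<open>N\<close> bounded terms come before,
    and afterwards \<open>P a i = P a N * P N i\<close> reduces to \<open>large\<close>.\<close>
  have small: "S a n \<le> real N * K + K * (2 / \<eta> * real N powr \<alpha>)" if "a \<le> N" for a n
  proof -
    have "S a n \<le> (\<Sum>i\<in>{a..<N} \<union> {N..n}. \<bar>P a i\<bar>)"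
      unfolding S_def by (intro sum_mono2) auto
    also have "\<dots> = (\<Sum>i\<in>{a..<N}. \<bar>P a i\<bar>) + (\<Sum>i\<in>{N..n}. \<bar>P a i\<bar>)"
      by (intro sum.union_disjoint) auto
    also have "(\<Sum>i\<in>{a..<N}. \<bar>P a i\<bar>) \<le> real (card {a..<N}) * K"
      by (intro sum_bounded_above K)
    also have "\<dots> \<le> real N * K" using K by (intro mult_right_mono) auto
    also have "(\<Sum>i\<in>{N..n}. \<bar>P a i\<bar>) = \<bar>P a N\<bar> * S N n"
      unfolding S_def sum_distrib_left using that
      by (intro sum.cong refl) (metis P_mult abs_mult atLeastAtMost_iff)
    also have "\<dots> \<le> K * (2 / \<eta> * real N powr \<alpha>)"
      using K large[of N n] by (intro mult_mono) (auto simp: S_def)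
    finally show ?thesis by simp
  qed
  \<comment> \<open>The 2 is \<open>s a\<close> times the bound in \<open>large\<close>; the other
    entry combines \<open>small\<close> with \<open>s a \<le> s 1 = \<eta>\<close>.\<close>
  define D where "D = max 2 (\<eta> * (real N * K + K * (2 / \<eta> * real N powr \<alpha>)))"
  have "(\<Sum>i\<in>{1..n}. \<bar>x i a\<bar>) \<le> D" for a n
  proof (cases "a = 0")
    case True then show ?thesis by (simp add: x_def D_def)
  next
    case False
    have "(\<Sum>i\<in>{1..n}. \<bar>x i a\<bar>) = (\<Sum>i\<in>{a..n}. \<bar>x i a\<bar>)"
      using False by (intro sum.mono_neutral_right) (auto simp: x_def)
    also have "\<dots> = s a * S a n"
      unfolding S_def sum_distrib_left using False s_nonneg
      by (intro sum.cong) (auto simp: x_def abs_mult)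
    also have "\<dots> \<le> D"
    proof (cases "a \<ge> N")
      case True
      have "s a * S a n \<le> s a * (2 / \<eta> * real a powr \<alpha>)"
        by (intro mult_left_mono large True s_nonneg)
      also have "\<dots> = 2" using eta_pos False by (simp add: step_size_def powr_minus field_simps)
      finally show ?thesis by (simp add: D_def)
    next
      case False
      have "s a \<le> s 1" using \<open>a \<noteq> 0\<close> by (intro s_antimono) auto
      then have "s a * S a n \<le> \<eta> * (real N * K + K * (2 / \<eta> * real N powr \<alpha>))"
        using False eta_pos by (intro mult_mono small) (auto simp: S_def step_size_def intro: sum_nonneg)
      then show ?thesis by (simp add: D_def)
    qed
    finally show ?thesis .
  qed
  then show ?thesis by blast
qed

text \<open>At lag \<open>C * i powr \<alpha> * ln i\<close> the powers of
  \<open>exp (- s i)\<close> have decayed to \<open>i powr (- \<eta> * C)\<close>, at most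
  \<open>1 / i\<close>; summing the geometric tail costs a factor of order \<open>1 / s i\<close>,
  that is \<open>i powr \<alpha>\<close>.\<close>

lemma P_outside_window_sum:
  assumes "\<eta> * C > 1"
  shows "\<exists>K>0. \<forall>i\<ge>1. (\<Sum>j | j < i \<and> int j < tstart C \<alpha> i. \<bar>P j i\<bar>) \<le> K * real i powr (\<alpha> - 1)"
proof -
  obtain K where K: "K > 0" "\<And>i j. i \<ge> 1 \<Longrightarrow> j \<le> i \<Longrightarrow> \<bar>P j i\<bar> \<le> K * exp (- s i) ^ (i - j)"
    using P_geometric_bound by auto
  define K' where "K' = K * exp \<eta> * ((1 + \<eta>) / \<eta>)"
  have "(\<Sum>j | j < i \<and> int j < tstart C \<alpha> i. \<bar>P j i\<bar>) \<le> K' * real i powr (\<alpha> - 1)" if i: "i \<ge> 1" for i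
  proof -
    define r where "r = exp (- s i)"
    \<comment> \<open>The condition \<open>int j < tstart C \<alpha> i\<close> says
      \<open>i - j \<ge> ell C \<alpha> i\<close>, so every omitted lag is at least
      \<open>d\<close>. Rounding in \<open>ell\<close> costs at most a factor
      \<open>exp (s i) \<le> exp \<eta>\<close>.\<close>
    define d where "d = nat (ell C \<alpha> i)"
    let ?S = "{j. j < i \<and> int j < tstart C \<alpha> i}"
    have s: "s i > 0" "s i \<le> \<eta>" using i eta_pos s_antimono[of 1 i] by (auto simp: step_size_def)
    then have r: "0 < r" "r < 1" by (auto simp: r_def)
    have d: "real d \<ge> C * real i powr \<alpha> * ln (real i) - 1"
      unfolding d_def ell_def by linarith
    have "(\<Sum>j\<in>?S. \<bar>P j i\<bar>) \<le> (\<Sum>j\<in>?S. K * r ^ (i - j))"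
      unfolding r_def using K(2) i by (intro sum_mono) auto
    also have "\<dots> \<le> K * (r ^ d / (1 - r))"
      unfolding sum_distrib_left[symmetric] using K(1)
      by (intro mult_left_mono sum_geometric_tail_le r) (auto simp: tstart_def d_def)
    also have "\<dots> = K * (r ^ d * (1 / (1 - r)))" by simp
    also have "\<dots> \<le> K * ((exp \<eta> * real i powr - 1) * ((1 + \<eta>) / \<eta> * real i powr \<alpha>))"
    proof (intro mult_left_mono mult_mono)
      have "r ^ d = exp (- (s i * real d))" by (simp add: r_def exp_of_nat_mult[symmetric] mult.commute)
      also have "\<dots> \<le> exp (- (s i * (C * real i powr \<alpha> * ln (real i) - 1)))"
        using s d by (simp del: times_divide_eq_right)
      also have "s i * (C * real i powr \<alpha> * ln (real i) - 1) = \<eta> * C * ln (real i) - s i"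
        using i by (simp add: step_size_def powr_minus field_simps)
      also have "exp (- (\<eta> * C * ln (real i) - s i)) \<le> exp (\<eta> - 1 * ln (real i))"
      proof -
        have "1 * ln (real i) \<le> \<eta> * C * ln (real i)" using assms i by (intro mult_right_mono) auto
        then show ?thesis using s by simp
      qed
      also have "\<dots> = exp \<eta> * real i powr - 1" using i by (simp add: exp_diff powr_minus field_simps)
      finally show "r ^ d \<le> exp \<eta> * real i powr - 1" .
      \<comment> \<open>This yields \<open>1 - r \<ge> s i / (1 + s i)\<close>.\<close>
      have "r * (1 + s i) \<le> r * exp (s i)" using r by (intro mult_left_mono exp_ge_add_one_self) auto
      then have "r * (1 + s i) \<le> 1" by (simp add: r_def exp_minus)
      then have "s i \<le> (1 - r) * (1 + s i)" by (simp add: algebra_simps)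
      also have "\<dots> \<le> (1 - r) * (1 + \<eta>)" using s r by (intro mult_left_mono) auto
      finally have "1 / (1 - r) \<le> (1 + \<eta>) / s i" using s r by (simp add: field_simps)
      also have "\<dots> = (1 + \<eta>) / \<eta> * real i powr \<alpha>"
        using i eta_pos by (simp add: step_size_def powr_minus field_simps)
      finally show "1 / (1 - r) \<le> (1 + \<eta>) / \<eta> * real i powr \<alpha>" .
    qed (use K(1) r eta_pos in auto)
    also have "\<dots> = K' * real i powr (\<alpha> - 1)"
      using i by (simp add: K'_def powr_diff powr_minus field_simps)
    finally show ?thesis .
  qed
  moreover have "K' > 0" using K(1) eta_pos by (simp add: K'_def)
  ultimately show ?thesis by blast
qed

section \<open>The estimator as a quadratic form\<close>

text \<open>Coefficient of X_i X_j in \<open>n\<close> times the estimator. The factor 2 stays on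
  pairs \<open>j < i\<close> instead of being split symmetrically.\<close>

definition u :: "real \<Rightarrow> nat \<Rightarrow> nat \<Rightarrow> real" where
  "u C i j = of_bool (i = j) + 2 * of_bool (j < i \<and> tstart C \<alpha> i \<le> int j)"

definition A :: "real \<Rightarrow> nat \<Rightarrow> nat \<Rightarrow> nat \<Rightarrow> real" where
  "A C n a b = (\<Sum>i\<in>{1..n}. \<Sum>j\<in>{1..n}. u C i j * (x i a * x j b))"

lemma u_nonneg: "0 \<le> u C i j" and u_le_2: "u C i j \<le> 2"
  by (auto simp: u_def)

text \<open>Stated for arbitrary \<open>v\<close>: \<open>u C\<close> gives the estimator, the
  constant 1 the squared sum behind \<open>sigma_true\<close>.\<close>

lemma sum_products_eq_quadratic_form:
  "(\<Sum>i\<in>{1..n}. \<Sum>j\<in>{1..n}. v i j * (Xseq \<eta> \<alpha> e i \<omega> * Xseq \<eta> \<alpha> e j \<omega>)) =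
   (\<Sum>a\<in>{1..n}. \<Sum>b\<in>{1..n}. (\<Sum>i\<in>{1..n}. \<Sum>j\<in>{1..n}. v i j * (x i a * x j b)) * (e a \<omega> * e b \<omega>))"
proof -
  let ?I = "{1..n}"
  have X: "Xseq \<eta> \<alpha> e i \<omega> * Xseq \<eta> \<alpha> e j \<omega> =
      (\<Sum>a\<in>?I. \<Sum>b\<in>?I. (x i a * e a \<omega>) * (x j b * e b \<omega>))" if "i \<in> ?I" "j \<in> ?I" for i j
    using that by (simp only: Xseq_eq_sum[of _ n] sum_product atLeastAtMost_iff)
  have "(\<Sum>i\<in>?I. \<Sum>j\<in>?I. v i j * (Xseq \<eta> \<alpha> e i \<omega> * Xseq \<eta> \<alpha> e j \<omega>)) =
      (\<Sum>i\<in>?I. \<Sum>j\<in>?I. \<Sum>a\<in>?I. \<Sum>b\<in>?I. v i j * (x i a * x j b) * (e a \<omega> * e b \<omega>))"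
    by (intro sum.cong refl) (simp add: X sum_distrib_left mult_ac)
  also have "\<dots> = (\<Sum>i\<in>?I. \<Sum>a\<in>?I. \<Sum>j\<in>?I. \<Sum>b\<in>?I. v i j * (x i a * x j b) * (e a \<omega> * e b \<omega>))"
    by (intro sum.cong refl sum.swap)
  also have "\<dots> = (\<Sum>a\<in>?I. \<Sum>i\<in>?I. \<Sum>j\<in>?I. \<Sum>b\<in>?I. v i j * (x i a * x j b) * (e a \<omega> * e b \<omega>))"
    by (rule sum.swap)
  also have "\<dots> = (\<Sum>a\<in>?I. \<Sum>i\<in>?I. \<Sum>b\<in>?I. \<Sum>j\<in>?I. v i j * (x i a * x j b) * (e a \<omega> * e b \<omega>))"
    by (intro sum.cong refl sum.swap)
  also have "\<dots> = (\<Sum>a\<in>?I. \<Sum>b\<in>?I. \<Sum>i\<in>?I. \<Sum>j\<in>?I. v i j * (x i a * x j b) * (e a \<omega> * e b \<omega>))"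
    by (intro sum.cong refl sum.swap)
  finally show ?thesis by (simp add: sum_distrib_right)
qed

text \<open>Over the naturals the cut at 0 is automatic, and index 0 drops out because X_0 =
  0.\<close>

lemma Wsum_eq:
  assumes "i \<le> n"
  shows "Wsum \<eta> \<alpha> C e i \<omega> =
    (\<Sum>j\<in>{1..n}. of_bool (j < i \<and> tstart C \<alpha> i \<le> int j) * Xseq \<eta> \<alpha> e j \<omega>)"
proof -
  have "Wsum \<eta> \<alpha> C e i \<omega> = (\<Sum>j | j < i \<and> tstart C \<alpha> i \<le> int j. Xseq \<eta> \<alpha> e j \<omega>)"
    unfolding Wsum_def by (rule sum.reindex_bij_witness[of _ int nat]) auto
  also have "\<dots> = (\<Sum>j | j \<in> {1..n} \<and> j < i \<and> tstart C \<alpha> i \<le> int j. Xseq \<eta> \<alpha> e j \<omega>)"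
  proof (rule sum.mono_neutral_right)
    show "\<forall>j\<in>{j. j < i \<and> tstart C \<alpha> i \<le> int j} - {j \<in> {1..n}. j < i \<and> tstart C \<alpha> i \<le> int j}.
      Xseq \<eta> \<alpha> e j \<omega> = 0"
    proof
      fix j assume "j \<in> {j. j < i \<and> tstart C \<alpha> i \<le> int j} - {j \<in> {1..n}. j < i \<and> tstart C \<alpha> i \<le> int j}"
      then have "j = 0" using assms by auto
      then show "Xseq \<eta> \<alpha> e j \<omega> = 0" by simp
    qed
  qed auto
  also have "\<dots> = (\<Sum>j\<in>{1..n}. of_bool (j < i \<and> tstart C \<alpha> i \<le> int j) * Xseq \<eta> \<alpha> e j \<omega>)"
    by (simp add: sum.inter_filter[symmetric] of_bool_def mult_delta_left)
  finally show ?thesis .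
qed

lemma sigma_hat_eq:
  "sigma_hat \<eta> \<alpha> C e n \<omega> = (1 / real n) * (\<Sum>a\<in>{1..n}. \<Sum>b\<in>{1..n}. A C n a b * (e a \<omega> * e b \<omega>))"
proof -
  let ?X = "\<lambda>i. Xseq \<eta> \<alpha> e i \<omega>"
  have "(?X i)\<^sup>2 + 2 * ?X i * Wsum \<eta> \<alpha> C e i \<omega> = (\<Sum>j\<in>{1..n}. u C i j * (?X i * ?X j))"
    if "i \<in> {1..n}" for i
  proof -
    have "(\<Sum>j\<in>{1..n}. of_bool (i = j) * (?X i * ?X j)) = (?X i)\<^sup>2"
      using that by (simp add: of_bool_def mult_delta_left power2_eq_square)
    moreover have "2 * ?X i * Wsum \<eta> \<alpha> C e i \<omega> =
        (\<Sum>j\<in>{1..n}. 2 * of_bool (j < i \<and> tstart C \<alpha> i \<le> int j) * (?X i * ?X j))"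
      using that by (simp only: Wsum_eq[of i n] sum_distrib_left atLeastAtMost_iff)
        (intro sum.cong refl, simp add: mult_ac)
    ultimately show ?thesis
      by (simp add: u_def distrib_right sum.distrib)
  qed
  then have "sigma_hat \<eta> \<alpha> C e n \<omega> = (1 / real n) * (\<Sum>i\<in>{1..n}. \<Sum>j\<in>{1..n}. u C i j * (?X i * ?X j))"
    unfolding sigma_hat_def by (intro arg_cong2[where f = "(*)"] refl sum.cong) auto
  then show ?thesis
    unfolding sum_products_eq_quadratic_form A_def .
qed

lemma square_sum_Xseq_eq:
  "(\<Sum>i=1..n. Xseq \<eta> \<alpha> e i \<omega>)\<^sup>2 =
   (\<Sum>a\<in>{1..n}. \<Sum>b\<in>{1..n}. (\<Sum>i\<in>{1..n}. \<Sum>j\<in>{1..n}. x i a * x j b) * (e a \<omega> * e b \<omega>))"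
  using sum_products_eq_quadratic_form[where v = "\<lambda>_ _. 1"]
  by (simp add: power2_eq_square sum_product)

section \<open>Bias of the estimator\<close>

text \<open>X_i equals \<open>P j i\<close> times X_j plus noises later than \<open>j\<close>, so
  the covariance is \<open>P j i\<close> times the variance of X_j, which the squared absolute row
  sum bounds.\<close>

lemma x_cov_bound:
  assumes "1 \<le> j" "j < i" "\<And>i. (\<Sum>a\<in>{1..i}. \<bar>x i a\<bar>) \<le> R"
  shows "\<bar>\<Sum>a\<in>{1..n}. x i a * x j a\<bar> \<le> R\<^sup>2 * \<bar>P j i\<bar>"
proof -
  have "(\<Sum>a\<in>{1..n}. (x j a)\<^sup>2) \<le> (\<Sum>a\<in>{1..j}. (x j a)\<^sup>2)"
    by (subst sum.mono_neutral_cong_right[of "{1..n}" "{1..min n j}" _ "\<lambda>a. (x j a)\<^sup>2"])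
       (auto simp: x_def intro!: sum_mono2)
  also have "\<dots> = (\<Sum>a\<in>{1..j}. \<bar>x j a\<bar> * \<bar>x j a\<bar>)" by (simp add: power2_eq_square)
  also have "\<dots> \<le> (\<Sum>a\<in>{1..j}. \<bar>x j a\<bar> * (\<Sum>b\<in>{1..j}. \<bar>x j b\<bar>))"
    by (intro sum_mono mult_left_mono member_le_sum) auto
  also have "\<dots> = (\<Sum>a\<in>{1..j}. \<bar>x j a\<bar>)\<^sup>2" by (simp add: sum_distrib_right power2_eq_square)
  also have "\<dots> \<le> R\<^sup>2" using assms(3) by (intro power_mono sum_nonneg) auto
  finally have var: "(\<Sum>a\<in>{1..n}. (x j a)\<^sup>2) \<le> R\<^sup>2" .
  have "\<bar>x i a * x j a\<bar> = \<bar>P j i\<bar> * (x j a)\<^sup>2" for a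
    using assms(2) by (cases "1 \<le> a \<and> a \<le> j")
      (auto simp: x_def P_mult[of a j i] abs_mult power2_eq_square)
  then have "\<bar>\<Sum>a\<in>{1..n}. x i a * x j a\<bar> \<le> (\<Sum>a\<in>{1..n}. \<bar>P j i\<bar> * (x j a)\<^sup>2)"
    by (metis (no_types, lifting) sum_abs sum.cong)
  also have "\<dots> = \<bar>P j i\<bar> * (\<Sum>a\<in>{1..n}. (x j a)\<^sup>2)" by (simp add: sum_distrib_left)
  also have "\<dots> \<le> \<bar>P j i\<bar> * R\<^sup>2" by (intro mult_left_mono var) auto
  finally show ?thesis by (simp add: mult.commute)
qed

text \<open>The difference is minus twice the covariances of the pairs outside the windows. Each
  \<open>i\<close> contributes order \<open>i powr (\<alpha> - 1)\<close>, which sums to order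
  \<open>n powr \<alpha>\<close>.\<close>

lemma bias_bound:
  assumes "\<eta> * C > 1"
  shows "\<exists>K. \<forall>n. \<bar>(\<Sum>a\<in>{1..n}. A C n a a) - (\<Sum>a\<in>{1..n}. \<Sum>i\<in>{1..n}. \<Sum>j\<in>{1..n}. x i a * x j a)\<bar>
    \<le> K * real n powr \<alpha>"
proof -
  obtain R where R: "\<And>i. (\<Sum>a\<in>{1..i}. \<bar>x i a\<bar>) \<le> R" using noise_weight_sum_bounded by blast
  obtain K where K: "K > 0"
    "\<And>i. i \<ge> 1 \<Longrightarrow> (\<Sum>j | j < i \<and> int j < tstart C \<alpha> i. \<bar>P j i\<bar>) \<le> K * real i powr (\<alpha> - 1)"
    using P_outside_window_sum[OF assms] by blast
  have "\<bar>(\<Sum>a\<in>{1..n}. A C n a a) - (\<Sum>a\<in>{1..n}. \<Sum>i\<in>{1..n}. \<Sum>j\<in>{1..n}. x i a * x j a)\<bar>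
    \<le> (2 * R\<^sup>2 * K / \<alpha>) * real n powr \<alpha>" for n
  proof -
    let ?I = "{1..n}"
    define c where "c i j = (\<Sum>a\<in>?I. x i a * x j a)" for i j
    have c_sym: "c i j = c j i" for i j unfolding c_def by (simp add: mult.commute)
    have swap: "(\<Sum>a\<in>?I. \<Sum>i\<in>?I. \<Sum>j\<in>?I. v i j * (x i a * x j a)) = (\<Sum>i\<in>?I. \<Sum>j\<in>?I. v i j * c i j)" for v
    proof -
      have "(\<Sum>a\<in>?I. \<Sum>i\<in>?I. \<Sum>j\<in>?I. v i j * (x i a * x j a)) =
          (\<Sum>i\<in>?I. \<Sum>a\<in>?I. \<Sum>j\<in>?I. v i j * (x i a * x j a))"
        by (rule sum.swap)
      also have "\<dots> = (\<Sum>i\<in>?I. \<Sum>j\<in>?I. \<Sum>a\<in>?I. v i j * (x i a * x j a))"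
        by (intro sum.cong refl sum.swap)
      finally show ?thesis by (simp add: c_def sum_distrib_left)
    qed
    \<comment> \<open>By symmetry of \<open>c\<close> the full sum is folded onto the diagonal and
      the lower triangle, the shape of \<open>u\<close>; the two sets of weights then differ only
      outside the windows.\<close>
    have "(\<Sum>i\<in>?I. \<Sum>j\<in>?I. c i j) =
      (\<Sum>i\<in>?I. \<Sum>j\<in>?I. of_bool (i = j) * c i j + of_bool (j < i) * c i j + of_bool (i < j) * c i j)"
      by (intro sum.cong refl) (auto simp: of_bool_def)
    also have "\<dots> = (\<Sum>i\<in>?I. \<Sum>j\<in>?I. of_bool (i = j) * c i j + of_bool (j < i) * c i j)
        + (\<Sum>i\<in>?I. \<Sum>j\<in>?I. of_bool (i < j) * c i j)"
      by (simp add: sum.distrib)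
    also have "(\<Sum>i\<in>?I. \<Sum>j\<in>?I. of_bool (i < j) * c i j) = (\<Sum>i\<in>?I. \<Sum>j\<in>?I. of_bool (j < i) * c i j)"
      by (subst sum.swap) (simp add: c_sym)
    also have "(\<Sum>i\<in>?I. \<Sum>j\<in>?I. of_bool (i = j) * c i j + of_bool (j < i) * c i j)
        + (\<Sum>i\<in>?I. \<Sum>j\<in>?I. of_bool (j < i) * c i j) =
      (\<Sum>i\<in>?I. \<Sum>j\<in>?I. (of_bool (i = j) + 2 * of_bool (j < i)) * c i j)"
      unfolding sum.distrib[symmetric] by (intro sum.cong refl) (simp add: algebra_simps)
    finally have full: "(\<Sum>i\<in>?I. \<Sum>j\<in>?I. c i j) =
      (\<Sum>i\<in>?I. \<Sum>j\<in>?I. (of_bool (i = j) + 2 * of_bool (j < i)) * c i j)" .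
    have "(\<Sum>a\<in>?I. A C n a a) - (\<Sum>a\<in>?I. \<Sum>i\<in>?I. \<Sum>j\<in>?I. x i a * x j a) =
      (\<Sum>i\<in>?I. \<Sum>j\<in>?I. u C i j * c i j) - (\<Sum>i\<in>?I. \<Sum>j\<in>?I. c i j)"
      unfolding A_def using swap[of "u C"] swap[of "\<lambda>_ _. 1"] by simp
    also have "\<dots> = - (\<Sum>i\<in>?I. \<Sum>j\<in>?I. 2 * (of_bool (j < i \<and> int j < tstart C \<alpha> i) * c i j))"
      unfolding full sum_subtractf[symmetric] sum_negf[symmetric]
      by (intro sum.cong refl) (auto simp: u_def of_bool_def)
    finally have "\<bar>(\<Sum>a\<in>?I. A C n a a) - (\<Sum>a\<in>?I. \<Sum>i\<in>?I. \<Sum>j\<in>?I. x i a * x j a)\<bar> =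
       \<bar>\<Sum>i\<in>?I. \<Sum>j\<in>?I. 2 * (of_bool (j < i \<and> int j < tstart C \<alpha> i) * c i j)\<bar>" by simp
    also have "\<dots> \<le> (\<Sum>i\<in>?I. \<Sum>j\<in>?I. \<bar>2 * (of_bool (j < i \<and> int j < tstart C \<alpha> i) * c i j)\<bar>)"
      by (intro order.trans[OF sum_abs] sum_mono sum_abs)
    also have "\<dots> \<le> (\<Sum>i\<in>?I. 2 * R\<^sup>2 * (K * real i powr (\<alpha> - 1)))"
    proof (intro sum_mono)
      fix i assume i: "i \<in> ?I"
      have "(\<Sum>j\<in>?I. \<bar>2 * (of_bool (j < i \<and> int j < tstart C \<alpha> i) * c i j)\<bar>) \<le>
         (\<Sum>j\<in>?I. 2 * R\<^sup>2 * (if j < i \<and> int j < tstart C \<alpha> i then \<bar>P j i\<bar> else 0))"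
        unfolding c_def using x_cov_bound[OF _ _ R] by (intro sum_mono) (auto simp: abs_mult mult.assoc)
      also have "\<dots> = 2 * R\<^sup>2 * (\<Sum>j | j \<in> ?I \<and> j < i \<and> int j < tstart C \<alpha> i. \<bar>P j i\<bar>)"
        by (simp add: sum_distrib_left[symmetric] sum.inter_filter[symmetric])
      also have "\<dots> \<le> 2 * R\<^sup>2 * (\<Sum>j | j < i \<and> int j < tstart C \<alpha> i. \<bar>P j i\<bar>)"
        by (intro mult_left_mono sum_mono2) auto
      also have "\<dots> \<le> 2 * R\<^sup>2 * (K * real i powr (\<alpha> - 1))"
        using i by (intro mult_left_mono K(2)) auto
      finally show "(\<Sum>j\<in>?I. \<bar>2 * (of_bool (j < i \<and> int j < tstart C \<alpha> i) * c i j)\<bar>) \<le>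
        2 * R\<^sup>2 * (K * real i powr (\<alpha> - 1))" .
    qed
    also have "\<dots> = 2 * R\<^sup>2 * K * (\<Sum>i\<in>?I. real i powr (\<alpha> - 1))"
      by (simp add: sum_distrib_left mult_ac)
    also have "\<dots> \<le> 2 * R\<^sup>2 * K * (real n powr \<alpha> / \<alpha>)"
      using K(1) by (intro mult_left_mono sum_powr_le alpha_pos alpha_less) auto
    finally show ?thesis by simp
  qed
  then show ?thesis by blast
qed

section \<open>Upper bound for the Frobenius norm\<close>

lemma window_size:
  assumes "C > 0" "1 \<le> i" "i \<le> n"
  shows "(\<Sum>j\<in>{1..n}. u C i j) \<le> 1 + 2 * (C * real n powr \<alpha> * ln (real n))"
proof -
  let ?S = "{j \<in> {1..n}. j < i \<and> tstart C \<alpha> i \<le> int j}"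
  have "(\<Sum>j\<in>{1..n}. u C i j) = 1 + 2 * (\<Sum>j\<in>{1..n}. of_bool (j < i \<and> tstart C \<alpha> i \<le> int j))"
    using assms by (simp add: u_def sum.distrib sum_distrib_left)
  also have "(\<Sum>j\<in>{1..n}. of_bool (j < i \<and> tstart C \<alpha> i \<le> int j)) = real (card ?S)"
    by (simp add: Int_def)
  also have "real (card ?S) \<le> C * real n powr \<alpha> * ln (real n)"
  proof -
    have "int ` ?S \<subseteq> {tstart C \<alpha> i..int i - 1}" by auto
    then have "card ?S \<le> card {tstart C \<alpha> i..int i - 1}"
      by (metis (no_types, lifting) card_image card_mono finite_atLeastAtMost_int inj_on_of_nat)
    also have "\<dots> \<le> nat (ell C \<alpha> i)" by (simp add: tstart_def)
    finally have "real (card ?S) \<le> real (nat (ell C \<alpha> i))" by simp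
    also have "\<dots> \<le> C * real i powr \<alpha> * ln (real i)"
      using assms by (simp add: ell_def)
    also have "\<dots> \<le> C * real n powr \<alpha> * ln (real n)"
      using assms alpha_pos by (intro mult_mono powr_mono2) auto
    finally show ?thesis .
  qed
  finally show ?thesis by simp
qed

text \<open>One factor of \<open>(A C n a b)\<^sup>2\<close> is bounded by the largest entry, at
  most \<open>2 * D\<^sup>2\<close> by the column sums. The entries then sum in absolute value to at
  most \<open>R\<^sup>2\<close> times the total of \<open>u\<close>, by the row sums.\<close>

lemma frobenius_upper_bound:
  assumes "C > 0"
  shows "\<exists>K. \<forall>n. (\<Sum>a\<in>{1..n}. \<Sum>b\<in>{1..n}. (A C n a b)\<^sup>2) \<le>
    K * (real n * (1 + 2 * (C * real n powr \<alpha> * ln (real n))))"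
proof -
  obtain R where R: "\<And>i. (\<Sum>a\<in>{1..i}. \<bar>x i a\<bar>) \<le> R" using noise_weight_sum_bounded by blast
  obtain D where D: "\<And>a n. (\<Sum>i\<in>{1..n}. \<bar>x i a\<bar>) \<le> D" using noise_influence_bounded by blast
  have R': "(\<Sum>a\<in>{1..n}. \<bar>x i a\<bar>) \<le> R" if "i \<le> n" for i n
  proof -
    have "(\<Sum>a\<in>{1..n}. \<bar>x i a\<bar>) = (\<Sum>a\<in>{1..i}. \<bar>x i a\<bar>)"
      using that by (intro sum.mono_neutral_right) (auto simp: x_def)
    with R show ?thesis by simp
  qed
  have R0: "R \<ge> 0" using R[of 0] by simp
  have D0: "D \<ge> 0" using D[where n = 0] by simp
  have "(\<Sum>a\<in>{1..n}. \<Sum>b\<in>{1..n}. (A C n a b)\<^sup>2) \<le>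
    (2 * D\<^sup>2 * R\<^sup>2) * (real n * (1 + 2 * (C * real n powr \<alpha> * ln (real n))))" for n
  proof -
    let ?I = "{1..n}"
    have abs_A: "\<bar>A C n a b\<bar> \<le> (\<Sum>i\<in>?I. \<Sum>j\<in>?I. u C i j * (\<bar>x i a\<bar> * \<bar>x j b\<bar>))" for a b
      unfolding A_def
      by (intro order.trans[OF sum_abs] sum_mono) (auto simp: abs_mult u_nonneg)
    have max_A: "\<bar>A C n a b\<bar> \<le> 2 * D\<^sup>2" for a b
    proof -
      note abs_A[of a b]
      also have "(\<Sum>i\<in>?I. \<Sum>j\<in>?I. u C i j * (\<bar>x i a\<bar> * \<bar>x j b\<bar>)) \<le>
          (\<Sum>i\<in>?I. \<Sum>j\<in>?I. 2 * (\<bar>x i a\<bar> * \<bar>x j b\<bar>))"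
        by (intro sum_mono mult_right_mono u_le_2) auto
      also have "\<dots> = 2 * ((\<Sum>i\<in>?I. \<bar>x i a\<bar>) * (\<Sum>j\<in>?I. \<bar>x j b\<bar>))"
        unfolding sum_product by (simp add: sum_distrib_left)
      also have "\<dots> \<le> 2 * (D * D)"
        using D0 by (intro mult_left_mono mult_mono D sum_nonneg) auto
      finally show ?thesis by (simp add: power2_eq_square)
    qed
    have "(\<Sum>a\<in>?I. \<Sum>b\<in>?I. (A C n a b)\<^sup>2) = (\<Sum>a\<in>?I. \<Sum>b\<in>?I. \<bar>A C n a b\<bar> * \<bar>A C n a b\<bar>)"
      by (simp add: power2_eq_square)
    also have "\<dots> \<le> (\<Sum>a\<in>?I. \<Sum>b\<in>?I. 2 * D\<^sup>2 * (\<Sum>i\<in>?I. \<Sum>j\<in>?I. u C i j * (\<bar>x i a\<bar> * \<bar>x j b\<bar>)))"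
      using max_A abs_A by (intro sum_mono mult_mono) auto
    also have "\<dots> = 2 * D\<^sup>2 * (\<Sum>a\<in>?I. \<Sum>b\<in>?I. \<Sum>i\<in>?I. \<Sum>j\<in>?I. u C i j * (\<bar>x i a\<bar> * \<bar>x j b\<bar>))"
      by (simp add: sum_distrib_left)
    also have "(\<Sum>a\<in>?I. \<Sum>b\<in>?I. \<Sum>i\<in>?I. \<Sum>j\<in>?I. u C i j * (\<bar>x i a\<bar> * \<bar>x j b\<bar>)) =
        (\<Sum>a\<in>?I. \<Sum>i\<in>?I. \<Sum>b\<in>?I. \<Sum>j\<in>?I. u C i j * (\<bar>x i a\<bar> * \<bar>x j b\<bar>))"
      by (intro sum.cong refl sum.swap)
    also have "\<dots> = (\<Sum>i\<in>?I. \<Sum>a\<in>?I. \<Sum>b\<in>?I. \<Sum>j\<in>?I. u C i j * (\<bar>x i a\<bar> * \<bar>x j b\<bar>))"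
      by (rule sum.swap)
    also have "\<dots> = (\<Sum>i\<in>?I. \<Sum>a\<in>?I. \<Sum>j\<in>?I. \<Sum>b\<in>?I. u C i j * (\<bar>x i a\<bar> * \<bar>x j b\<bar>))"
      by (intro sum.cong refl sum.swap)
    also have "\<dots> = (\<Sum>i\<in>?I. \<Sum>j\<in>?I. \<Sum>a\<in>?I. \<Sum>b\<in>?I. u C i j * (\<bar>x i a\<bar> * \<bar>x j b\<bar>))"
      by (intro sum.cong refl sum.swap)
    also have "\<dots> = (\<Sum>i\<in>?I. \<Sum>j\<in>?I. u C i j * ((\<Sum>a\<in>?I. \<bar>x i a\<bar>) * (\<Sum>b\<in>?I. \<bar>x j b\<bar>)))"
      unfolding sum_product by (simp add: sum_distrib_left)
    also have "\<dots> \<le> (\<Sum>i\<in>?I. \<Sum>j\<in>?I. u C i j * (R * R))"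
      using R0 by (intro sum_mono mult_left_mono mult_mono R' u_nonneg sum_nonneg) auto
    also have "\<dots> = R\<^sup>2 * (\<Sum>i\<in>?I. \<Sum>j\<in>?I. u C i j)"
      by (simp add: sum_distrib_left power2_eq_square mult_ac)
    also have "(\<Sum>i\<in>?I. \<Sum>j\<in>?I. u C i j) \<le> (\<Sum>i\<in>?I. 1 + 2 * (C * real n powr \<alpha> * ln (real n)))"
      by (intro sum_mono window_size assms) auto
    also have "\<dots> = real n * (1 + 2 * (C * real n powr \<alpha> * ln (real n)))"
      by simp
    finally show ?thesis by (simp add: mult_left_mono mult.assoc)
  qed
  then show ?thesis by blast
qed

section \<open>Lower bound for the Frobenius norm\<close>

text \<open>The product has at most \<open>m\<close> factors, each at least \<open>1 - s h\<close>;
  Bernoulli's inequality gives \<open>1 - m * s h\<close>.\<close>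

lemma P_ge_half:
  assumes "1 \<le> h" "h \<le> b" "b \<le> i" "i \<le> b + m" "real m * s h \<le> 1/2" "s h \<le> 1"
  shows "1/2 \<le> P b i"
proof -
  have "1 - real m * s h \<le> 1 + real (i - b) * (- s h)"
    using assms s_nonneg[of h] by (simp add: mult_right_mono)
  also have "\<dots> \<le> (1 + - s h) ^ (i - b)"
    using assms by (intro Bernoulli_inequality) auto
  also have "\<dots> = (\<Prod>k\<in>{b<..i}. 1 - s h)" by simp
  also have "\<dots> \<le> P b i"
    unfolding P_def using assms by (intro prod_mono) (auto intro: s_antimono)
  finally show ?thesis using assms(5) by linarith
qed

lemma x_nonneg:
  assumes "\<And>k. k \<ge> N \<Longrightarrow> s k \<le> 1" "N \<le> a"
  shows "0 \<le> x i a"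
  using assms s_nonneg unfolding x_def P_def by (auto intro!: mult_nonneg_nonneg prod_nonneg)

lemma A_nonneg:
  assumes "\<And>k. k \<ge> N \<Longrightarrow> s k \<le> 1" "N \<le> a" "N \<le> b"
  shows "0 \<le> A C n a b"
  unfolding A_def using assms
  by (intro sum_nonneg mult_nonneg_nonneg u_nonneg x_nonneg[of N]) auto

text \<open>Only the \<open>m\<close> by \<open>m\<close> block of times from \<open>b\<close> and
  from \<open>a\<close> on is kept: there \<open>u\<close> is 2 and both weights are at least
  \<open>s n / 2\<close>. The condition \<open>a + m < b\<close> keeps the block below the diagonal,
  and the dropped terms are nonnegative because \<open>a\<close> and \<open>b\<close> are at least
  \<open>N\<close>.\<close>

lemma A_lower:
  assumes N: "\<And>k. k \<ge> N \<Longrightarrow> s k \<le> 1"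
    and h: "1 \<le> h" "N \<le> h" "real m * s h \<le> 1/2" "h \<le> a" "a + m < b" "b + m \<le> n + 1" "1 \<le> m"
    and win: "\<And>i j. b \<le> i \<Longrightarrow> i < b + m \<Longrightarrow> a \<le> j \<Longrightarrow> tstart C \<alpha> i \<le> int j"
  shows "(real m * s n)\<^sup>2 / 2 \<le> A C n b a"
proof -
  have x_ge: "s n / 2 \<le> x i c" if "h \<le> c" "c \<le> i" "i < c + m" "i \<le> n" for c i
  proof -
    have "s n * (1/2) \<le> s c * P c i"
      using that h s_nonneg by (intro mult_mono s_antimono P_ge_half[of h _ _ m]) (auto intro: N)
    then show ?thesis using that h by (simp add: x_def)
  qed
  have "(real m * s n)\<^sup>2 / 2 = (\<Sum>i\<in>{b..<b+m}. \<Sum>j\<in>{a..<a+m}. 2 * (s n / 2 * (s n / 2)))"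
    by (simp add: power2_eq_square field_simps)
  also have "\<dots> \<le> (\<Sum>i\<in>{b..<b+m}. \<Sum>j\<in>{a..<a+m}. u C i j * (x i b * x j a))"
  proof (intro sum_mono mult_mono)
    fix i j assume ij: "i \<in> {b..<b+m}" "j \<in> {a..<a+m}"
    then have "j < i" "tstart C \<alpha> i \<le> int j" using win[of i j] h by auto
    then show "2 \<le> u C i j" by (simp add: u_def)
    show "s n / 2 \<le> x i b" "s n / 2 \<le> x j a" using x_ge[of b i] x_ge[of a j] ij h by auto
    then show "0 \<le> x i b" using s_nonneg[of n] by linarith
  qed (use s_nonneg u_nonneg in auto)
  also have "\<dots> \<le> (\<Sum>i\<in>{b..<b+m}. \<Sum>j\<in>{1..n}. u C i j * (x i b * x j a))"
    using h by (intro sum_mono sum_mono2)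
      (auto intro!: mult_nonneg_nonneg u_nonneg x_nonneg[of N] N)
  also have "\<dots> \<le> A C n b a"
    unfolding A_def using h by (intro sum_mono2)
      (auto intro!: sum_nonneg mult_nonneg_nonneg u_nonneg x_nonneg[of N] N)
  finally show ?thesis .
qed

text \<open>The right side is half the squared Frobenius norm of \<open>B\<close> plus its
  transpose, so pairs outside \<open>F\<close> may be dropped; nonnegative transposed entries
  exclude cancellation inside \<open>F\<close>.\<close>

lemma symmetrized_frobenius_lower:
  fixes B :: "nat \<Rightarrow> nat \<Rightarrow> real"
  assumes "F \<subseteq> {1..n} \<times> {1..n}" "0 \<le> q" "\<And>b a. (b, a) \<in> F \<Longrightarrow> q \<le> B b a \<and> 0 \<le> B a b"
  shows "real (card F) * q\<^sup>2 / 2 \<le> (\<Sum>a\<in>{1..n}. \<Sum>b\<in>{1..n}. (B a b)\<^sup>2 + B a b * B b a)"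
proof -
  let ?I = "{1..n}"
  have "(\<Sum>a\<in>?I. \<Sum>b\<in>?I. (B b a)\<^sup>2) = (\<Sum>a\<in>?I. \<Sum>b\<in>?I. (B a b)\<^sup>2)" by (rule sum.swap)
  then have sym: "(\<Sum>a\<in>?I. \<Sum>b\<in>?I. (B a b + B b a)\<^sup>2) =
      2 * (\<Sum>a\<in>?I. \<Sum>b\<in>?I. (B a b)\<^sup>2 + B a b * B b a)"
    by (simp add: power2_sum sum.distrib sum_distrib_left mult.assoc)
  have "real (card F) * q\<^sup>2 = (\<Sum>p\<in>F. q\<^sup>2)" by simp
  also have "\<dots> \<le> (\<Sum>p\<in>F. (B (fst p) (snd p) + B (snd p) (fst p))\<^sup>2)"
    using assms by (intro sum_mono power_mono) force+
  also have "\<dots> \<le> (\<Sum>p\<in>?I \<times> ?I. (B (fst p) (snd p) + B (snd p) (fst p))\<^sup>2)"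
    using assms(1) by (intro sum_mono2) auto
  also have "\<dots> = (\<Sum>a\<in>?I. \<Sum>b\<in>?I. (B a b + B b a)\<^sup>2)"
    by (simp add: sum.cartesian_product case_prod_beta)
  finally show ?thesis using sym by simp
qed

lemma frobenius_lower_bound:
  assumes C: "C > 0"
  shows "\<exists>c>0. \<forall>\<^sub>F n in sequentially. c * (real n * real n powr \<alpha> * ln (real n)) \<le>
     (\<Sum>a\<in>{1..n}. \<Sum>b\<in>{1..n}. (A C n a b)\<^sup>2 + A C n a b * A C n b a)"
proof -
  obtain N where N: "N \<ge> 1" "\<And>k. k \<ge> N \<Longrightarrow> s k \<le> 1" using s_eventually_le_1 by auto
  let ?p = "\<lambda>h::nat. real h powr \<alpha>"
  \<comment> \<open>These conditions give, in order: nonnegative weights, \<open>m\<close> at least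
    half of \<open>?p h / (2 * \<eta>)\<close>, \<open>m \<le> h\<close>, \<open>L \<le> h\<close>,
    a window longer than \<open>L + m\<close>, and \<open>L - m\<close> of the order of the
    window.\<close>
  have "\<forall>\<^sub>F h in sequentially. N \<le> h \<and> 1 \<le> h \<and> 4 * \<eta> \<le> ?p h \<and> ?p h / (2 * \<eta>) \<le> real h \<and>
      C / 2 * ?p h * ln (real h) \<le> real h \<and>
      C / 2 * ?p h * ln (real h) + ?p h / (2 * \<eta>) + 1 \<le> C * ?p h * ln (real h) \<and>
      C / 4 * ?p h * ln (real h) \<le> C / 2 * ?p h * ln (real h) - 1 - ?p h / (2 * \<eta>)"
    by (intro eventually_conj eventually_ge_at_top; use alpha_pos alpha_less eta_pos C in real_asymp)
  then obtain h0 where h0: "\<And>h. h \<ge> h0 \<Longrightarrow> N \<le> h \<and> 1 \<le> h \<and> 4 * \<eta> \<le> ?p h \<and> ?p h / (2 * \<eta>) \<le> real h \<and>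
      C / 2 * ?p h * ln (real h) \<le> real h \<and>
      C / 2 * ?p h * ln (real h) + ?p h / (2 * \<eta>) + 1 \<le> C * ?p h * ln (real h) \<and>
      C / 4 * ?p h * ln (real h) \<le> C / 2 * ?p h * ln (real h) - 1 - ?p h / (2 * \<eta>)"
    unfolding eventually_sequentially by blast
  \<comment> \<open>Here \<open>C / 4\<close> comes from \<open>L - m\<close> and
    \<open>1 / 8192\<close> bounds \<open>q\<close>; 256 is \<open>8 * 8 * 2\<close> from replacing
    \<open>n\<close> by \<open>h\<close> in the three factors, times 2 from the
    symmetrization.\<close>
  define c where "c = C / 4 * (1 / 8192)\<^sup>2 / 256"
  have "c * (real n * real n powr \<alpha> * ln (real n)) \<le>
     (\<Sum>a\<in>{1..n}. \<Sum>b\<in>{1..n}. (A C n a b)\<^sup>2 + A C n a b * A C n b a)" if n: "n \<ge> max 64 (4 * h0)" for n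
  proof -
    define h where "h = n div 4"
    have "h \<ge> h0" using n by (simp add: h_def less_eq_div_iff_mult_less_eq)
    note hs = h0[OF this]
    then have h1: "1 \<le> h" "N \<le> h" by auto
    have hn: "4 * h \<le> n" "n \<le> 8 * h" using n by (auto simp: h_def)
    \<comment> \<open>As \<open>s h = \<eta> / ?p h\<close>, this is the largest \<open>m\<close>
      with \<open>m * s h \<le> 1/2\<close>; \<open>L\<close> is about half the window length at
      time \<open>h\<close>.\<close>
    define m where "m = nat \<lfloor>?p h / (2 * \<eta>)\<rfloor>"
    define L where "L = nat \<lfloor>C / 2 * ?p h * ln (real h)\<rfloor>"
    have p0: "?p h > 0" using h1 by simp
    have lnh: "ln (real h) \<ge> 0" using h1 by simp
    have floor: "real (nat \<lfloor>y\<rfloor>) \<le> y \<and> y - 1 \<le> real (nat \<lfloor>y\<rfloor>)" if "0 \<le> y" for y :: real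
      using that by linarith
    have m: "real m \<le> ?p h / (2 * \<eta>)" "?p h / (2 * \<eta>) - 1 \<le> real m"
      using floor[of "?p h / (2 * \<eta>)"] eta_pos unfolding m_def by auto
    have L: "real L \<le> C / 2 * ?p h * ln (real h)" "C / 2 * ?p h * ln (real h) - 1 \<le> real L"
      using floor[of "C / 2 * ?p h * ln (real h)"] C lnh unfolding L_def by auto
    have m_ge: "?p h / (4 * \<eta>) \<le> real m"
    proof -
      have "?p h / (2 * \<eta>) - 1 \<ge> ?p h / (4 * \<eta>)" using hs eta_pos by (simp add: field_simps)
      with m show ?thesis by linarith
    qed
    have "real m > 0" using m_ge p0 eta_pos by (smt (verit) divide_pos_pos mult_pos_pos)
    then have m1: "1 \<le> m" by simp
    have mh: "m \<le> h" "L \<le> h" using m L hs by linarith+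
    have LmR: "C / 4 * ?p h * ln (real h) \<le> real L - real m" using L m hs by linarith
    moreover have "0 \<le> C / 4 * ?p h * ln (real h)" using C lnh by simp
    ultimately have mL: "m \<le> L" by linarith
    have ms: "real m * s h \<le> 1/2"
    proof -
      have "real m * s h \<le> ?p h / (2 * \<eta>) * s h" by (intro mult_right_mono m s_nonneg)
      also have "\<dots> = 1/2" using h1 eta_pos by (simp add: step_size_def powr_minus field_simps)
      finally show ?thesis .
    qed
    \<comment> \<open>The lag \<open>i - j\<close> is below \<open>L + m\<close>, while the window
      at \<open>i \<ge> h\<close> is at least as long as the one at \<open>h\<close>.\<close>
    have win: "tstart C \<alpha> i \<le> int j" if "b \<le> i" "i < b + m" "b \<le> a + L" "a \<le> j" "h \<le> b" for a b i j
    proof -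
      have "real L + real m + 1 \<le> C * ?p h * ln (real h)" using L m hs by linarith
      also have "\<dots> \<le> C * ?p i * ln (real i)"
        using that h1 C alpha_pos by (intro mult_mono powr_mono2) auto
      finally have "int (L + m + 1) \<le> ell C \<alpha> i" unfolding ell_def by (simp add: le_floor_iff)
      then show ?thesis using that by (simp add: tstart_def)
    qed
    have pn: "?p n \<le> 8 * ?p h"
    proof -
      have "?p n \<le> (8 * real h) powr \<alpha>" using hn alpha_pos by (intro powr_mono2) auto
      also have "\<dots> = 8 powr \<alpha> * ?p h" by (simp add: powr_mult)
      also have "\<dots> \<le> 8 powr 1 * ?p h" using alpha_less by (intro mult_right_mono powr_mono) auto
      finally show ?thesis by simp
    qed
    define q where "q = (real m * s n)\<^sup>2 / 2"
    have q: "1 / 8192 \<le> q"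
    proof -
      have "1 / 64 \<le> real m * s n"
      proof -
        have "1 / 8 \<le> ?p h / ?p n" using pn h1 hn by (simp add: field_simps)
        also have "?p h / ?p n = 4 * (?p h / (4 * \<eta>) * s n)"
          using eta_pos by (simp add: step_size_def powr_minus field_simps)
        also have "\<dots> \<le> 4 * (real m * s n)" by (intro mult_left_mono mult_right_mono m_ge s_nonneg) auto
        finally show ?thesis by simp
      qed
      then have "(1/64)\<^sup>2 \<le> (real m * s n)\<^sup>2" by (intro power_mono) auto
      then show ?thesis by (simp add: q_def power2_eq_square)
    qed
    \<comment> \<open>For these \<open>b\<close>, the bounds \<open>m \<le> h\<close> and
      \<open>L \<le> h\<close> keep \<open>a \<ge> h\<close> and
      \<open>b + m \<le> 4 * h \<le> n\<close>; the lag \<open>b - a\<close> lies above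
      \<open>m\<close> and is at most \<open>L\<close>.\<close>
    define F where "F = (SIGMA b:{2*h<..3*h}. {b - L..<b - m})"
    have "real (card F) * q\<^sup>2 / 2 \<le> (\<Sum>a\<in>{1..n}. \<Sum>b\<in>{1..n}. (A C n a b)\<^sup>2 + A C n a b * A C n b a)"
    proof (rule symmetrized_frobenius_lower)
      show "F \<subseteq> {1..n} \<times> {1..n}" using mh hn h1 by (auto simp: F_def)
      show "0 \<le> q" by (simp add: q_def)
      fix b a assume "(b, a) \<in> F"
      then have ba: "2 * h < b" "b \<le> 3 * h" "b \<le> a + L" "a + m < b" by (auto simp: F_def)
      then have "h \<le> a" using mh by linarith
      then have "q \<le> A C n b a" unfolding q_def
        using ba h1 ms mh hn m1 by (intro A_lower[of N h] N win[of b _ a]) auto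
      moreover have "0 \<le> A C n a b"
        using ba h1 \<open>h \<le> a\<close> by (intro A_nonneg[of N] N) auto
      ultimately show "q \<le> A C n b a \<and> 0 \<le> A C n a b" by blast
    qed
    moreover have "c * (real n * real n powr \<alpha> * ln (real n)) \<le> real (card F) * q\<^sup>2 / 2"
    proof -
      have "card F = (\<Sum>b\<in>{2*h<..3*h}. L - m)"
        unfolding F_def by (subst card_SigmaI) (use mh mL in \<open>auto intro!: sum.cong\<close>)
      then have cardF: "real (card F) = real h * (real L - real m)" using mL by (simp add: of_nat_diff)
      \<comment> \<open>The bound \<open>n \<ge> 64\<close> gives \<open>h \<ge> 8\<close>, hence
        \<open>n \<le> 8 * h \<le> h * h\<close>.\<close>
      have lnn: "ln (real n) \<le> 2 * ln (real h)"
      proof -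
        have "8 \<le> h" using n hn by simp
        then have "8 * h \<le> h * h" by simp
        then have "real n \<le> real h * real h" using hn by (metis of_nat_le_iff of_nat_mult order.trans)
        then have "ln (real n) \<le> ln (real h * real h)" using n by (subst ln_le_cancel_iff) auto
        then show ?thesis using h1 by (simp add: ln_mult)
      qed
      have "real n * ?p n * ln (real n) \<le> (8 * real h) * (8 * ?p h) * (2 * ln (real h))"
        using hn n lnh by (intro mult_mono pn lnn) auto
      then have "c * (real n * ?p n * ln (real n)) \<le> c * ((8 * real h) * (8 * ?p h) * (2 * ln (real h)))"
        using C by (intro mult_left_mono) (auto simp: c_def)
      also have "\<dots> = real h * (C / 4 * ?p h * ln (real h)) * (1 / 8192)\<^sup>2 / 2"
        by (simp add: c_def)
      also have "\<dots> \<le> real h * (real L - real m) * q\<^sup>2 / 2"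
        using q LmR mL C lnh by (intro divide_right_mono mult_mono power_mono) auto
      finally show ?thesis by (simp add: cardF)
    qed
    ultimately show ?thesis by linarith
  qed
  moreover have "c > 0" using C by (simp add: c_def)
  ultimately show ?thesis unfolding eventually_sequentially by blast
qed

end

section \<open>The mean squared error\<close>

locale sgd_noise = sgd \<eta> \<alpha> + iid_normal M e \<sigma>
  for \<eta> \<alpha> :: real and M :: "'a measure" and e \<sigma>
begin

lemma mse_eq:
  assumes "n \<ge> 1"
  shows "(\<integral>\<omega>. (sigma_hat \<eta> \<alpha> C e n \<omega> - sigma_true M \<eta> \<alpha> e n)\<^sup>2 \<partial>M) = \<sigma> ^ 4 / (real n)\<^sup>2 *
    ((\<Sum>a\<in>{1..n}. \<Sum>b\<in>{1..n}. (A C n a b)\<^sup>2 + A C n a b * A C n b a) +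
     ((\<Sum>a\<in>{1..n}. A C n a a) - (\<Sum>a\<in>{1..n}. \<Sum>i\<in>{1..n}. \<Sum>j\<in>{1..n}. x i a * x j a))\<^sup>2)"
proof -
  let ?I = "{1..n}"
  let ?T = "\<Sum>a\<in>?I. \<Sum>i\<in>?I. \<Sum>j\<in>?I. x i a * x j a"
  have I: "finite ?I" "?I \<subseteq> {1..}" by auto
  have "(\<integral>\<omega>. (\<Sum>i=1..n. Xseq \<eta> \<alpha> e i \<omega>)\<^sup>2 \<partial>M) = \<sigma>\<^sup>2 * ?T"
    unfolding square_sum_Xseq_eq
    using quadratic_form_mean[OF I] by (rule has_bochner_integral_integral_eq)
  then have sigma: "sigma_true M \<eta> \<alpha> e n = (1 / real n) * (\<sigma>\<^sup>2 * ?T)"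
    by (simp add: sigma_true_def)
  have "(\<integral>\<omega>. (sigma_hat \<eta> \<alpha> C e n \<omega> - sigma_true M \<eta> \<alpha> e n)\<^sup>2 \<partial>M) =
      (\<integral>\<omega>. (1 / real n)\<^sup>2 * ((\<Sum>a\<in>?I. \<Sum>b\<in>?I. A C n a b * (e a \<omega> * e b \<omega>)) - \<sigma>\<^sup>2 * ?T)\<^sup>2 \<partial>M)"
    unfolding sigma_hat_eq sigma right_diff_distrib[symmetric] power_mult_distrib ..
  also have "\<dots> = (1 / real n)\<^sup>2 * (\<sigma> ^ 4 * (\<Sum>a\<in>?I. \<Sum>b\<in>?I. (A C n a b)\<^sup>2 + A C n a b * A C n b a) +
      (\<sigma>\<^sup>2 * (\<Sum>a\<in>?I. A C n a a) - \<sigma>\<^sup>2 * ?T)\<^sup>2)"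
    by (simp only: integral_mult_right_zero quadratic_form_mse[OF I])
  also have "\<sigma>\<^sup>2 * (\<Sum>a\<in>?I. A C n a a) - \<sigma>\<^sup>2 * ?T = \<sigma>\<^sup>2 * ((\<Sum>a\<in>?I. A C n a a) - ?T)"
    by (simp only: right_diff_distrib)
  also have "(\<sigma>\<^sup>2 * ((\<Sum>a\<in>?I. A C n a a) - ?T))\<^sup>2 = \<sigma> ^ 4 * ((\<Sum>a\<in>?I. A C n a a) - ?T)\<^sup>2"
    by (simp add: power_mult_distrib flip: power_mult)
  finally show ?thesis
    unfolding distrib_left[symmetric] by (simp only: power_one_over times_divide_eq_left mult_1_left mult_1_right)
qed

text \<open>The squared bias is dropped; division by \<open>n\<^sup>2\<close> turns the Frobenius
  bound into the claimed rate.\<close>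

lemma mse_lower:
  assumes "C > 0"
  shows "\<exists>c>0. \<forall>\<^sub>F n in sequentially. c * (real n powr (\<alpha> - 1) * ln (real n))
    \<le> (\<integral>\<omega>. (sigma_hat \<eta> \<alpha> C e n \<omega> - sigma_true M \<eta> \<alpha> e n)\<^sup>2 \<partial>M)"
proof -
  obtain c where c: "c > 0" "\<forall>\<^sub>F n in sequentially. c * (real n * real n powr \<alpha> * ln (real n)) \<le>
     (\<Sum>a\<in>{1..n}. \<Sum>b\<in>{1..n}. (A C n a b)\<^sup>2 + A C n a b * A C n b a)"
    using frobenius_lower_bound[OF assms] by blast
  have "\<forall>\<^sub>F n in sequentially. (\<sigma> ^ 4 * c) * (real n powr (\<alpha> - 1) * ln (real n))
    \<le> (\<integral>\<omega>. (sigma_hat \<eta> \<alpha> C e n \<omega> - sigma_true M \<eta> \<alpha> e n)\<^sup>2 \<partial>M)"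
    using c(2) eventually_ge_at_top[of 1]
  proof eventually_elim
    case (elim n)
    have "(\<sigma> ^ 4 * c) * (real n powr (\<alpha> - 1) * ln (real n)) =
        \<sigma> ^ 4 / (real n)\<^sup>2 * (c * (real n * real n powr \<alpha> * ln (real n)))"
      using elim(2) by (simp add: powr_diff power2_eq_square field_simps)
    also have "\<dots> \<le> \<sigma> ^ 4 / (real n)\<^sup>2 *
      ((\<Sum>a\<in>{1..n}. \<Sum>b\<in>{1..n}. (A C n a b)\<^sup>2 + A C n a b * A C n b a) +
       ((\<Sum>a\<in>{1..n}. A C n a a) - (\<Sum>a\<in>{1..n}. \<Sum>i\<in>{1..n}. \<Sum>j\<in>{1..n}. x i a * x j a))\<^sup>2)"
      using elim(1) by (intro mult_left_mono add_increasing2) auto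
    finally show ?case using mse_eq[OF elim(2)] by simp
  qed
  then show ?thesis using c(1) sd_pos by (intro exI[of _ "\<sigma> ^ 4 * c"]) auto
qed

text \<open>The products \<open>A a b * A b a\<close> at most double the squared Frobenius norm. The
  squared bias is of order \<open>n powr (2 * \<alpha>)\<close>, dominated by
  \<open>n * n powr \<alpha>\<close> because \<open>\<alpha> < 1\<close>.\<close>

lemma mse_upper:
  assumes "\<eta> * C > 1"
  shows "\<exists>c'>0. \<forall>\<^sub>F n in sequentially.
    (\<integral>\<omega>. (sigma_hat \<eta> \<alpha> C e n \<omega> - sigma_true M \<eta> \<alpha> e n)\<^sup>2 \<partial>M)
      \<le> c' * (real n powr (\<alpha> - 1) * ln (real n))"
proof -
  have C: "C > 0" using assms eta_pos by (smt (verit) zero_less_mult_pos)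
  obtain K1 where K1: "\<And>n. (\<Sum>a\<in>{1..n}. \<Sum>b\<in>{1..n}. (A C n a b)\<^sup>2) \<le>
      K1 * (real n * (1 + 2 * (C * real n powr \<alpha> * ln (real n))))"
    using frobenius_upper_bound[OF C] by blast
  obtain K2 where K2: "\<And>n. \<bar>(\<Sum>a\<in>{1..n}. A C n a a) -
      (\<Sum>a\<in>{1..n}. \<Sum>i\<in>{1..n}. \<Sum>j\<in>{1..n}. x i a * x j a)\<bar> \<le> K2 * real n powr \<alpha>"
    using bias_bound[OF assms] by blast
  \<comment> \<open>\<open>K1\<close> has no known sign, hence the absolute value;
    \<open>1 + 2 * C\<close> absorbs the diagonal of \<open>u\<close> into the logarithmic term.
    Passing to \<open>K + 1\<close> below makes the constant strictly positive.\<close>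
  define K where "K = 2 * \<bar>K1\<bar> * (1 + 2 * C) + K2\<^sup>2"
  have "\<forall>\<^sub>F n in sequentially. (\<integral>\<omega>. (sigma_hat \<eta> \<alpha> C e n \<omega> - sigma_true M \<eta> \<alpha> e n)\<^sup>2 \<partial>M)
      \<le> \<sigma> ^ 4 * (K + 1) * (real n powr (\<alpha> - 1) * ln (real n))"
    \<comment> \<open>From 3 on, \<open>ln n \<ge> 1\<close>.\<close>
    using eventually_ge_at_top[of 3]
  proof eventually_elim
    case (elim n)
    let ?I = "{1..n}"
    define g where "g = real n * real n powr \<alpha> * ln (real n)"
    have ln1: "1 \<le> ln (real n)"
    proof -
      have "exp 1 \<le> real n" using exp_le elim by linarith
      then show ?thesis using elim by (subst ln_ge_iff) auto
    qed
    have p1: "1 \<le> real n powr \<alpha>" using elim alpha_pos by (intro ge_one_powr_ge_zero) auto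
    have "real n powr \<alpha> \<le> real n powr 1" using elim alpha_less by (intro powr_mono) auto
    then have pn: "real n powr \<alpha> \<le> real n" by simp
    have g0: "g \<ge> 0" using ln1 by (simp add: g_def)
    have "(\<Sum>a\<in>?I. \<Sum>b\<in>?I. A C n a b * A C n b a) \<le>
        (\<Sum>a\<in>?I. \<Sum>b\<in>?I. ((A C n a b)\<^sup>2 + (A C n b a)\<^sup>2) / 2)"
    proof (intro sum_mono)
      fix a b
      show "A C n a b * A C n b a \<le> ((A C n a b)\<^sup>2 + (A C n b a)\<^sup>2) / 2"
        using sum_squares_bound[of "A C n a b" "A C n b a"] by simp
    qed
    also have "\<dots> = (\<Sum>a\<in>?I. \<Sum>b\<in>?I. (A C n a b)\<^sup>2)"
    proof -
      have "(\<Sum>a\<in>?I. \<Sum>b\<in>?I. (A C n b a)\<^sup>2) = (\<Sum>a\<in>?I. \<Sum>b\<in>?I. (A C n a b)\<^sup>2)" by (rule sum.swap)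
      then show ?thesis by (simp add: sum_divide_distrib[symmetric] sum.distrib)
    qed
    finally have "(\<Sum>a\<in>?I. \<Sum>b\<in>?I. (A C n a b)\<^sup>2 + A C n a b * A C n b a) \<le>
        2 * (K1 * (real n * (1 + 2 * (C * real n powr \<alpha> * ln (real n)))))"
      using K1[of n] by (simp add: sum.distrib)
    also have "\<dots> \<le> 2 * (\<bar>K1\<bar> * ((1 + 2 * C) * g))"
    proof -
      have "1 * 1 \<le> real n powr \<alpha> * ln (real n)" using p1 ln1 by (intro mult_mono) auto
      then have "real n * (1 + 2 * (C * real n powr \<alpha> * ln (real n))) \<le>
          real n * (real n powr \<alpha> * ln (real n) + 2 * (C * real n powr \<alpha> * ln (real n)))"
        by (intro mult_left_mono) auto
      also have "\<dots> = (1 + 2 * C) * g" by (simp add: g_def algebra_simps)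
      finally have "\<bar>K1\<bar> * (real n * (1 + 2 * (C * real n powr \<alpha> * ln (real n)))) \<le> \<bar>K1\<bar> * ((1 + 2 * C) * g)"
        by (intro mult_left_mono) auto
      moreover have "K1 * (real n * (1 + 2 * (C * real n powr \<alpha> * ln (real n)))) \<le>
          \<bar>K1\<bar> * (real n * (1 + 2 * (C * real n powr \<alpha> * ln (real n))))"
        using C ln1 by (intro mult_right_mono) auto
      ultimately show ?thesis by linarith
    qed
    finally have var: "(\<Sum>a\<in>?I. \<Sum>b\<in>?I. (A C n a b)\<^sup>2 + A C n a b * A C n b a) \<le>
        2 * \<bar>K1\<bar> * (1 + 2 * C) * g" by (simp add: mult.assoc)
    have "((\<Sum>a\<in>?I. A C n a a) - (\<Sum>a\<in>?I. \<Sum>i\<in>?I. \<Sum>j\<in>?I. x i a * x j a))\<^sup>2 \<le> (K2 * real n powr \<alpha>)\<^sup>2"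
      using K2[of n] by (subst abs_le_square_iff[symmetric]) linarith
    also have "\<dots> = K2\<^sup>2 * (real n powr \<alpha> * real n powr \<alpha> * 1)" by (simp add: power2_eq_square)
    also have "\<dots> \<le> K2\<^sup>2 * g" unfolding g_def
      using pn ln1 by (intro mult_left_mono mult_mono) auto
    finally have bias: "((\<Sum>a\<in>?I. A C n a a) - (\<Sum>a\<in>?I. \<Sum>i\<in>?I. \<Sum>j\<in>?I. x i a * x j a))\<^sup>2 \<le> K2\<^sup>2 * g" .
    have "(\<integral>\<omega>. (sigma_hat \<eta> \<alpha> C e n \<omega> - sigma_true M \<eta> \<alpha> e n)\<^sup>2 \<partial>M) \<le> \<sigma> ^ 4 / (real n)\<^sup>2 *
      (2 * \<bar>K1\<bar> * (1 + 2 * C) * g + K2\<^sup>2 * g)"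
      using elim by (subst mse_eq) (simp, intro mult_left_mono add_mono var bias, simp)
    also have "\<dots> = \<sigma> ^ 4 / (real n)\<^sup>2 * (K * g)" by (simp add: K_def distrib_right)
    also have "\<dots> \<le> \<sigma> ^ 4 / (real n)\<^sup>2 * ((K + 1) * g)"
      using g0 by (intro mult_left_mono mult_right_mono) auto
    also have "\<dots> = \<sigma> ^ 4 * (K + 1) * (real n powr (\<alpha> - 1) * ln (real n))"
      using elim unfolding g_def by (simp add: powr_diff power2_eq_square)
    finally show ?case .
  qed
  moreover have "\<sigma> ^ 4 * (K + 1) > 0"
    using sd_pos C by (intro mult_pos_pos) (auto simp: K_def intro!: add_nonneg_pos)
  ultimately show ?thesis by blast
qed

end

theorem theoremC1:
  fixes M :: "'a measure" and e :: "nat \<Rightarrow> 'a \<Rightarrow> real"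
    and \<eta> \<alpha> C \<sigma> :: real
  assumes "prob_space M"
    and "\<eta> > 0" and "1/2 < \<alpha>" and "\<alpha> < 1"
    and "\<eta> * C > 1"
    and "\<sigma> > 0"
    and "prob_space.indep_vars M (\<lambda>_. borel) e {1..}"
    and "\<forall>i\<ge>1. distributed M lborel (e i) (normal_density 0 \<sigma>)"
  shows "\<exists>c C'. 0 < c \<and> 0 < C' \<and>
    (\<forall>\<^sub>F n in sequentially.
       c * (real n powr (\<alpha> - 1) * ln (real n))
         \<le> (\<integral>\<omega>. (sigma_hat \<eta> \<alpha> C e n \<omega> - sigma_true M \<eta> \<alpha> e n)\<^sup>2 \<partial>M)
     \<and> (\<integral>\<omega>. (sigma_hat \<eta> \<alpha> C e n \<omega> - sigma_true M \<eta> \<alpha> e n)\<^sup>2 \<partial>M)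
         \<le> C' * (real n powr (\<alpha> - 1) * ln (real n)))"
proof -
  interpret prob_space M by fact
  interpret sgd_noise \<eta> \<alpha> M e \<sigma>
    using assms by unfold_locales auto
  have "C > 0" using assms(2,5) by (smt (verit) zero_less_mult_pos)
  from mse_lower[OF this] mse_upper[OF assms(5)] show ?thesis
    unfolding eventually_conj_iff by blast
qed

end
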